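(* Assume the setting of the context. Let $x\in X$, $z\in Z$, $v\in T_xX$ and let $z_t$ be an $h$-segment at $x$. Set $y_t=g\text{-exp}_{z_t}(-D_zh(x,z_t))$. Then, for $u=\dot y_t$ (at $t=0$), $MTW^b_{(x,y_0)}\langle v,u\rangle$ is given by $$\frac{d^2}{dt^2}\Big|_{t=0} v^T\cdot\Big(D^2_{xx}h(x,z_t)-D^2_{xz}h(x,z_t)\cdot\big(D^2_{zz}h(x,z_t)+D^2_{zz}g(y_t,z_t)\big)^{-1}\cdot D^2_{zx}h(x,z_t)\Big)\cdot v .$$
   Context: $X,Y,Z$ are smooth manifolds of the same dimension $n$, smoothly embedded in larger manifolds so that their closures $\overline X,\overline Y,\overline Z$ are compact; $h\in C^2(\overline X\times\overline Z)$ and $g\in C^2(\overline Y\times\overline Z)$. Put $b(x,y)=\sup_{z\in Z}\big(h(x,z)+g(y,z)\big)$. Standing assumptions: for each $(x,y)$ the supremum is attained by a unique $z(x,y)\in Z$; and for all $(x,y)$ the $n\times n$ matrix $D^2_{zz}h(x,z(x,y))+D^2_{zz}g(y,z(x,y))$ is non-singular. Derivatives are taken in local coordinates, and $D^2_{zx}h$ is the transpose of $D^2_{xz}h$. $h$ is $(x,z)$-twisted: for all $x\in\overline X$ the map $z\mapsto D_xh(x,z)$ is injective on $\overline Z$; its inverse on its range is denoted $h\text{-exp}_x(\cdot)$. An $h$-segment at $x$ is a curve $t\mapsto z_t=h\text{-exp}_x(tp+q)\in Z$ with $p,q\in T_x^*X$, i.e. $D_xh(x,z_t)=tp+q$. $g$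 is $(z,y)$-twisted: for all $z\in\overline Z$ the map $y\mapsto D_zg(y,z)$ is injective on $\overline Y$; its inverse on its range is denoted $g\text{-exp}_z(\cdot)$, so that $y_t=g\text{-exp}_{z_t}(-D_zh(x,z_t))$ means $D_zg(y_t,z_t)=-D_zh(x,z_t)$. The Ma-Trudinger-Wang curvature of $b$ is defined under the following conditions, which are assumed: (A0) $b\in C^4(\overline X\times\overline Y)$; (A1) for all $x\in\overline X$ the map $y\mapsto D_xb(x,y)$ is injective on $\overline Y$, and for all $y\in\overline Y$ the map $x\mapsto D_yb(x,y)$ is injective on $\overline X$; (A2) for all $(x,y)$ the matrix $D^2_{xy}b(x,y)$ of mixed second partials is non-singular; and $Y$ is $b$-convex, i.e. for all $x$ the set $D_xb(x,Y)\subseteq T_x^*X$ is convex. The inverse of $y\mapsto D_xb(x,y)$ on its range is denoted $b\text{-exp}_x(\cdot)$. For $x\in X$, $y\in Y$, $v\in T_xX$, $u\in T_yY$, set $q=D_xb(x,y)\in T_x^*X$ and $p=(D^2_{xy}b(x,y))\cdot u\in T_x^*X$. For any smooth curve $\beta(s)$ in $X$ with $\beta(0)=x$ and $\frac{d\beta}{ds}(0)=v$, $$MTW^b_{(x,y)}\langle v,u\rangle:=\frac{\partial^4}{\partial s^2\partial t^2}\Big|_{s=t=0}b\big(\beta(s),b\text{-exp}_x(tp+q)\big).$$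
   Formalization: It is additionally assumed that z=z_0 is the maximizer z(x,y_0); without this, z_0 may be another critical point of h(x,·)+g(y_0,·), and the formula can then fail. *)

theory Defs
  imports "HOL-Analysis.Analysis"
begin

text \<open>\<open>Ck_on k S f\<close> is intended for open \<open>S\<close>: all iterated directional derivatives of \<open>f\<close> up to
  order \<open>k\<close> exist on \<open>S\<close> and are continuous there.\<close>

primrec Ck_on :: "nat \<Rightarrow> 'a::real_normed_vector set \<Rightarrow> ('a \<Rightarrow> 'b::real_normed_vector) \<Rightarrow> bool" where
  "Ck_on 0 S f \<longleftrightarrow> continuous_on S f"
| "Ck_on (Suc k) S f \<longleftrightarrow>
     (\<forall>a\<in>S. f differentiable (at a)) \<and> (\<forall>w. Ck_on k S (\<lambda>a. frechet_derivative f (at a) w))"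

type_synonym ('m, 'n) chart = "'m set \<times> ('m \<Rightarrow> real ^ 'n)"

definition chart_inv :: "('m, 'n) chart \<Rightarrow> real ^ 'n \<Rightarrow> 'm" where
  "chart_inv c = inv_into (fst c) (snd c)"

definition smooth_atlas ::
  "('m::{t2_space,second_countable_topology}, 'n::finite) chart set \<Rightarrow> bool" where
  "smooth_atlas A \<longleftrightarrow>
     (\<Union>c\<in>A. fst c) = UNIV \<and>
     (\<forall>c\<in>A. open (fst c) \<and> open (snd c ` fst c) \<and>
        homeomorphism (fst c) (snd c ` fst c) (snd c) (chart_inv c)) \<and>
     (\<forall>c\<in>A. \<forall>d\<in>A. \<forall>k. Ck_on k (snd c ` (fst c \<inter> fst d)) (snd d \<circ> chart_inv c))"

definition charts_at :: "('m, 'n) chart set \<Rightarrow> 'm \<Rightarrow> ('m, 'n) chart set" where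
  "charts_at A x = {c \<in> A. x \<in> fst c}"

text \<open>\<open>Ck_prod A B k S f\<close>: on the product of the manifolds with atlases \<open>A\<close> and \<open>B\<close>, the function
  \<open>f\<close> is of class C^k on an open neighbourhood of \<open>S\<close>. This is how membership in
  C^k of the closure of an open set is rendered: \<open>f\<close> itself plays the role of a C^k extension
  of its restriction to \<open>S\<close>. If \<open>S\<close> is the closure of an open set then, by continuity, the derivatives
  of \<open>f\<close> up to order \<open>k\<close> at points of \<open>S\<close> do not depend on the extension.\<close>

definition Ck_prod ::
  "('m::topological_space, 'n::finite) chart set \<Rightarrow> ('k::topological_space, 'n) chart set \<Rightarrow> nat
     \<Rightarrow> ('m \<times> 'k) set \<Rightarrow> ('m \<Rightarrow> 'k \<Rightarrow> real) \<Rightarrow> bool" where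
  "Ck_prod A B k S f \<longleftrightarrow>
     (\<exists>W. open W \<and> S \<subseteq> W \<and>
        (\<forall>c\<in>A. \<forall>d\<in>B.
           Ck_on k (map_prod (snd c) (snd d) ` (W \<inter> fst c \<times> fst d))
             (\<lambda>(\<xi>, \<zeta>). f (chart_inv c \<xi>) (chart_inv d \<zeta>))))"

definition grad :: "(real ^ 'n \<Rightarrow> real) \<Rightarrow> real ^ 'n::finite \<Rightarrow> real ^ 'n" where
  "grad F a = (\<chi> i. frechet_derivative F (at a) (axis i 1))"

text \<open>For a function \<open>f x y\<close>, \<open>D1 c f x y\<close> and \<open>D2 d f x y\<close> are the covectors of first partial derivatives
  in \<open>x\<close> and in \<open>y\<close>, with respect to a chart \<open>c\<close> around \<open>x\<close> and a chart \<open>d\<close> around \<open>y\<close>. In the mixed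
  matrix \<open>D12 c d f x y\<close> the rows are indexed by the coordinates of \<open>x\<close> and the columns by those
  of \<open>y\<close>.\<close>

definition D1 :: "('m, 'n::finite) chart \<Rightarrow> ('m \<Rightarrow> 'k \<Rightarrow> real) \<Rightarrow> 'm \<Rightarrow> 'k \<Rightarrow> real ^ 'n" where
  "D1 c f x y = grad (\<lambda>\<xi>. f (chart_inv c \<xi>) y) (snd c x)"

definition D2 :: "('k, 'n::finite) chart \<Rightarrow> ('m \<Rightarrow> 'k \<Rightarrow> real) \<Rightarrow> 'm \<Rightarrow> 'k \<Rightarrow> real ^ 'n" where
  "D2 d f x y = grad (\<lambda>\<zeta>. f x (chart_inv d \<zeta>)) (snd d y)"

definition D11 :: "('m, 'n::finite) chart \<Rightarrow> ('m \<Rightarrow> 'k \<Rightarrow> real) \<Rightarrow> 'm \<Rightarrow> 'k \<Rightarrow> real ^ 'n ^ 'n" where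
  "D11 c f x y = jacobian (\<lambda>\<xi>. D1 c f (chart_inv c \<xi>) y) (at (snd c x))"

definition D12 ::
  "('m, 'n::finite) chart \<Rightarrow> ('k, 'n) chart \<Rightarrow> ('m \<Rightarrow> 'k \<Rightarrow> real) \<Rightarrow> 'm \<Rightarrow> 'k \<Rightarrow> real ^ 'n ^ 'n" where
  "D12 c d f x y = jacobian (\<lambda>\<zeta>. D1 c f x (chart_inv d \<zeta>)) (at (snd d y))"

definition D22 :: "('k, 'n::finite) chart \<Rightarrow> ('m \<Rightarrow> 'k \<Rightarrow> real) \<Rightarrow> 'm \<Rightarrow> 'k \<Rightarrow> real ^ 'n ^ 'n" where
  "D22 d f x y = jacobian (\<lambda>\<zeta>. D2 d f x (chart_inv d \<zeta>)) (at (snd d y))"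

definition twisted1 ::
  "('m, 'n::finite) chart set \<Rightarrow> 'm set \<Rightarrow> 'k set \<Rightarrow> ('m \<Rightarrow> 'k \<Rightarrow> real) \<Rightarrow> bool" where
  "twisted1 A S T f \<longleftrightarrow> (\<forall>x\<in>S. \<forall>c\<in>charts_at A x. inj_on (\<lambda>y. D1 c f x y) T)"

definition twisted2 ::
  "('k, 'n::finite) chart set \<Rightarrow> 'm set \<Rightarrow> 'k set \<Rightarrow> ('m \<Rightarrow> 'k \<Rightarrow> real) \<Rightarrow> bool" where
  "twisted2 B S T f \<longleftrightarrow> (\<forall>y\<in>T. \<forall>d\<in>charts_at B y. inj_on (\<lambda>x. D2 d f x y) S)"

definition cost_convex ::
  "('m, 'n::finite) chart set \<Rightarrow> 'm set \<Rightarrow> 'k set \<Rightarrow> ('m \<Rightarrow> 'k \<Rightarrow> real) \<Rightarrow> bool" where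
  "cost_convex A X Y b \<longleftrightarrow> (\<forall>x\<in>X. \<forall>c\<in>charts_at A x. convex ((\<lambda>y. D1 c b x y) ` Y))"

definition is_maximizer ::
  "'k set \<Rightarrow> ('m \<Rightarrow> 'k \<Rightarrow> real) \<Rightarrow> ('l \<Rightarrow> 'k \<Rightarrow> real) \<Rightarrow> 'm \<Rightarrow> 'l \<Rightarrow> 'k \<Rightarrow> bool" where
  "is_maximizer Z h g x y z \<longleftrightarrow> z \<in> Z \<and> (\<forall>z'\<in>Z. h x z' + g y z' \<le> h x z + g y z)"

definition zmax ::
  "'k set \<Rightarrow> ('m \<Rightarrow> 'k \<Rightarrow> real) \<Rightarrow> ('l \<Rightarrow> 'k \<Rightarrow> real) \<Rightarrow> 'm \<Rightarrow> 'l \<Rightarrow> 'k" where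
  "zmax Z h g x y = (THE z. is_maximizer Z h g x y z)"

definition bexp ::
  "('m, 'n::finite) chart \<Rightarrow> 'k::topological_space set \<Rightarrow> ('m \<Rightarrow> 'k \<Rightarrow> real) \<Rightarrow> 'm \<Rightarrow> real ^ 'n \<Rightarrow> 'k" where
  "bexp c Y b x = inv_into (closure Y) (\<lambda>y. D1 c b x y)"

definition has_second_derivative :: "(real \<Rightarrow> real) \<Rightarrow> real \<Rightarrow> real \<Rightarrow> bool" where
  "has_second_derivative f m a \<longleftrightarrow>
     (\<exists>f'. (\<forall>\<^sub>F t in nhds a. (f has_real_derivative f' t) (at t)) \<and> (f' has_real_derivative m) (at a))"

text \<open>The tangent vector \<open>v\<close> is given by its coordinates in the chart \<open>c\<close> around \<open>x\<close>.\<close>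

definition smooth_curve_through ::
  "('m::topological_space, 'n::finite) chart set \<Rightarrow> 'm set \<Rightarrow> ('m, 'n) chart \<Rightarrow> 'm \<Rightarrow> real ^ 'n
     \<Rightarrow> (real \<Rightarrow> 'm) \<Rightarrow> bool" where
  "smooth_curve_through A X c x v \<beta> \<longleftrightarrow>
     (\<exists>J. open J \<and> is_interval J \<and> 0 \<in> J \<and> \<beta> ` J \<subseteq> X \<and> continuous_on J \<beta> \<and>
        (\<forall>a\<in>A. \<forall>k. Ck_on k {s \<in> J. \<beta> s \<in> fst a} (\<lambda>s. snd a (\<beta> s)))) \<and>
     \<beta> 0 = x \<and> ((\<lambda>s. snd c (\<beta> s)) has_vector_derivative v) (at 0)"

text \<open>\<open>has_MTW A X Y b c e x y v u m\<close>: the curvature of \<open>b\<close> at \<open>(x, y)\<close> on the tangent vectors with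
  coordinates \<open>v\<close> and \<open>u\<close> (in the charts \<open>c\<close> around \<open>x\<close> and \<open>e\<close> around \<open>y\<close>) exists and equals \<open>m\<close>.
  The mixed derivative is iterated as in its notation, first twice in \<open>t\<close>, then twice in \<open>s\<close>, and
  the value has to be the same for every admissible curve \<open>\<beta>\<close>. There is at least one such curve
  if \<open>x\<close> lies in the open set \<open>X\<close>, so \<open>m\<close> is then unique.\<close>

definition has_MTW ::
  "('m::topological_space, 'n::finite) chart set \<Rightarrow> 'm set \<Rightarrow> 'k::topological_space set
     \<Rightarrow> ('m \<Rightarrow> 'k \<Rightarrow> real) \<Rightarrow> ('m, 'n) chart \<Rightarrow> ('k, 'n) chart
     \<Rightarrow> 'm \<Rightarrow> 'k \<Rightarrow> real ^ 'n \<Rightarrow> real ^ 'n \<Rightarrow> real \<Rightarrow> bool" where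
  "has_MTW A X Y b c e x y v u m \<longleftrightarrow>
     (let q = D1 c b x y; p = D12 c e b x y *v u in
      \<forall>\<beta>. smooth_curve_through A X c x v \<beta> \<longrightarrow>
        (\<exists>w. (\<forall>\<^sub>F s in nhds 0.
                has_second_derivative (\<lambda>t. b (\<beta> s) (bexp c Y b x (t *\<^sub>R p + q))) (w s) 0) \<and>
             has_second_derivative w m 0))"

end

theory Submission
  imports Defs
begin

text \<open>By the envelope theorem \<open>D\<^sub>x b(x, y) = D\<^sub>x h(x, z(x, y))\<close>, and \<open>z(x, y)\<close> is a critical point of
  \<open>h(x, \<sqdot>) + g(y, \<sqdot>)\<close>. Hence if \<open>D\<^sub>x b(x, y'\<^sub>t) = tp + q\<close>, the twist of \<open>h\<close> forces \<open>z(x, y'\<^sub>t) = z\<^sub>t\<close>, and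
  then the twist of \<open>g\<close> forces \<open>y'\<^sub>t = y\<^sub>t\<close>: the given curve is \<open>b-exp\<^sub>x(tp + q)\<close>. Differentiating
  the envelope identity in \<open>x\<close>, with \<open>D\<^sub>x z\<close> computed from the critical point equation,
  turns the matrix in the theorem into \<open>D\<^sup>2\<^sub>x\<^sub>x b(x, y\<^sub>t)\<close>. In local coordinates the fourth
  partial derivatives of \<open>b\<close> commute, so the curvature is the second \<open>t\<close>-derivative of
  \<open>\<beta>'\<^sup>T D\<^sup>2\<^sub>x\<^sub>x b(x, y\<^sub>t) \<beta>' + D\<^sub>x b(x, y\<^sub>t) \<beta>''\<close>, whose second summand is affine in \<open>t\<close>.\<close>

section \<open>Directional derivatives\<close>

text \<open>\<open>h\<close> and \<open>g\<close> are only C^2, so the entries of the matrix in the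
  claim are merely continuous functions and cannot be differentiated along the segment one by one.
  The second t-derivative is therefore taken from \<open>b\<close>, which is C^4, once all
  expressions in \<open>h\<close>, \<open>g\<close> and the maximizer are identified near t = 0 with
  expressions in \<open>b\<close>. This needs the maximizer to be differentiable in x, and the
  implicit differentiation that shows it presupposes continuity, which must come from compactness
  instead. That z_t is the maximizer is known only at t = 0. For small t it comes from
  \<open>b\<close>: the map y -> D_x b(x, y) sends a neighbourhood of y_0 onto an open set, which
  contains tp + q. So every statement along the segment concerns germs at t = 0. A function of two
  manifold points is read in a pair of charts as one function on R^n x R^n. Its partial derivatives
  are directional derivatives in directions (w, 0) or (0, w), so one symmetry lemma serves for every
  exchange of derivatives.\<close>

definition dirderiv :: "'a::real_normed_vector \<Rightarrow> ('a \<Rightarrow> 'b::real_normed_vector) \<Rightarrow> 'a \<Rightarrow> 'b" where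
  "dirderiv w f a = frechet_derivative f (at a) w"

text \<open>With the direction as first argument, \<open>dirderiv w\<close> maps functions to
  functions and can be iterated; \<open>Ck_on\<close> is unfolded through this operator.\<close>

lemma Ck_on_Suc_dirderiv:
  "Ck_on (Suc k) S f \<longleftrightarrow> (\<forall>a\<in>S. f differentiable (at a)) \<and> (\<forall>w. Ck_on k S (dirderiv w f))"
  by (simp add: dirderiv_def[abs_def])

lemma Ck_on_SucD: "Ck_on (Suc k) S f \<Longrightarrow> Ck_on k S f"
proof (induction k arbitrary: f)
  case 0
  then show ?case
    by (simp add: differentiable_imp_continuous_on differentiable_at_imp_differentiable_on)
next
  case (Suc k)
  then show ?case
    by (metis Ck_on_Suc_dirderiv)
qed

lemma Ck_on_le: "Ck_on k S f \<Longrightarrow> j \<le> k \<Longrightarrow> Ck_on j S f"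
  by (induction k) (auto simp: le_Suc_eq simp del: Ck_on.simps dest: Ck_on_SucD)

lemma Ck_on_dirderiv: "Ck_on (Suc k) S f \<Longrightarrow> Ck_on k S (dirderiv w f)"
  by (simp only: Ck_on_Suc_dirderiv)

lemma Ck_on_differentiable: "Ck_on k S f \<Longrightarrow> k > 0 \<Longrightarrow> a \<in> S \<Longrightarrow> f differentiable (at a)"
  by (cases k) auto

lemma Ck_on_continuous: "Ck_on k S f \<Longrightarrow> continuous_on S f"
  using Ck_on_le[of k S f 0] by simp

lemma has_derivative_dirderiv:
  "f differentiable (at a) \<Longrightarrow> (f has_derivative (\<lambda>w. dirderiv w f a)) (at a)"
  by (simp add: dirderiv_def frechet_derivative_works)

lemma dirderiv_eq: "(f has_derivative f') (at a) \<Longrightarrow> dirderiv w f a = f' w"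
  by (metis dirderiv_def frechet_derivative_at)

lemma linear_dirderiv: "f differentiable (at a) \<Longrightarrow> linear (\<lambda>w. dirderiv w f a)"
  using has_derivative_dirderiv has_derivative_linear by blast

lemma dirderiv_cong:
  assumes "open S" "a \<in> S" "\<And>b. b \<in> S \<Longrightarrow> f b = g b" "f differentiable (at a)"
  shows "dirderiv w f a = dirderiv w g a"
  unfolding dirderiv_def using frechet_derivative_transform_within_open assms by metis

lemma has_real_derivative_along:
  fixes F :: "'a::real_normed_vector \<Rightarrow> real"
  assumes "(\<gamma> has_vector_derivative v) (at t)" "F differentiable (at (\<gamma> t))"
  shows "((\<lambda>t. F (\<gamma> t)) has_real_derivative dirderiv v F (\<gamma> t)) (at t)"
proof -
  have "((\<lambda>t. F (\<gamma> t)) has_derivative (\<lambda>h. dirderiv (h *\<^sub>R v) F (\<gamma> t))) (at t)"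
    using has_derivative_compose[OF assms(1)[unfolded has_vector_derivative_def], of F]
      has_derivative_dirderiv[OF assms(2)] by blast
  moreover have "dirderiv (h *\<^sub>R v) F (\<gamma> t) = dirderiv v F (\<gamma> t) * h" for h
    using linear_cmul[OF linear_dirderiv[OF assms(2)], of h v] by simp
  ultimately show ?thesis by (simp add: has_field_derivative_def)
qed

text \<open>The second difference of \<open>f\<close> over a small parallelogram does not depend on
  the order of its sides, and the mean value theorem, used twice, expresses it as t^2 times either
  mixed derivative at a nearby point. If the mixed derivatives differed at \<open>a\<close>,
  continuity would keep their nearby values apart.\<close>

lemma dirderiv_commute:
  fixes f :: "'a::real_normed_vector \<Rightarrow> real"
  assumes "open S" "Ck_on 2 S f" "a \<in> S"
  shows "dirderiv v (dirderiv w f) a = dirderiv w (dirderiv v f) a"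
proof (rule ccontr)
  define A where "A = dirderiv v (dirderiv w f)"
  define B where "B = dirderiv w (dirderiv v f)"
  assume "\<not> ?thesis"
  then have neq: "A a \<noteq> B a" by (simp add: A_def B_def)
  have C2: "Ck_on (Suc (Suc 0)) S f"
    using assms(2) by (simp only: numeral_2_eq_2)
  have cA: "continuous_on S A" and cB: "continuous_on S B"
    unfolding A_def B_def using Ck_on_dirderiv[OF Ck_on_dirderiv[OF C2]] Ck_on_continuous by auto
  have d1: "f differentiable (at b)" if "b \<in> S" for b
    using C2 that by auto
  have d2: "dirderiv u f differentiable (at b)" if "b \<in> S" for u b
    using Ck_on_dirderiv[OF C2] that by auto
  \<comment> \<open>Half the gap: a value within \<open>e\<close> of \<open>A a\<close> cannot equal
    a value within \<open>e\<close> of \<open>B a\<close>.\<close>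
  define e where "e = dist (A a) (B a) / 2"
  have "e > 0" using neq by (simp add: e_def)
  from cA assms have "\<forall>\<^sub>F b in nhds a. dist (A b) (A a) < e"
    by (metis \<open>e > 0\<close> continuous_on_eq_continuous_at isCont_def tendsto_at_iff_tendsto_nhds tendstoD)
  moreover from cB assms have "\<forall>\<^sub>F b in nhds a. dist (B b) (B a) < e"
    by (metis \<open>e > 0\<close> continuous_on_eq_continuous_at isCont_def tendsto_at_iff_tendsto_nhds tendstoD)
  moreover have "\<forall>\<^sub>F b in nhds a. b \<in> S"
    using assms by (metis eventually_nhds)
  ultimately have "\<forall>\<^sub>F b in nhds a. dist (A b) (A a) < e \<and> dist (B b) (B a) < e \<and> b \<in> S"
    by eventually_elim simp
  then obtain r where r: "r > 0"
    "\<And>b. dist b a < r \<Longrightarrow> dist (A b) (A a) < e \<and> dist (B b) (B a) < e \<and> b \<in> S"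
    by (auto simp: eventually_nhds_metric)
  \<comment> \<open>This size keeps the parallelogram with sides t v and t w inside the ball of
    radius \<open>r\<close>; the summand 1 keeps the denominator positive when both directions
    vanish.\<close>
  define t where "t = r / (norm v + norm w + 1)"
  have tpos: "t > 0" using r(1) by (auto simp: t_def intro!: divide_pos_pos add_nonneg_pos)
  have near: "dist (a + s *\<^sub>R v + s' *\<^sub>R w) a < r" if "0 \<le> s" "s \<le> t" "0 \<le> s'" "s' \<le> t" for s s'
  proof -
    have "dist (a + s *\<^sub>R v + s' *\<^sub>R w) a \<le> norm (s *\<^sub>R v) + norm (s' *\<^sub>R w)"
      using norm_triangle_ineq[of "s *\<^sub>R v" "s' *\<^sub>R w"] by (simp add: dist_norm add.assoc)
    also have "\<dots> = s * norm v + s' * norm w" using that by simp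
    also have "\<dots> \<le> t * norm v + t * norm w"
      using that by (intro add_mono mult_right_mono) auto
    also have "\<dots> < t * (norm v + norm w + 1)" using tpos by (simp add: algebra_simps)
    also have "\<dots> = r" unfolding t_def by (smt (verit) norm_ge_zero nonzero_eq_divide_eq)
    finally show ?thesis .
  qed
  \<comment> \<open>Stated for arbitrary \<open>v'\<close> and \<open>w'\<close> because it is
    applied to both orders of the two directions.\<close>
  have key: "\<exists>b. dist b a < r \<and> f (a + t *\<^sub>R v' + t *\<^sub>R w') - f (a + t *\<^sub>R v') - f (a + t *\<^sub>R w') + f a
      = t * t * dirderiv v' (dirderiv w' f) b"
    if nr: "\<And>s s'. 0 \<le> s \<Longrightarrow> s \<le> t \<Longrightarrow> 0 \<le> s' \<Longrightarrow> s' \<le> t \<Longrightarrow> dist (a + s *\<^sub>R v' + s' *\<^sub>R w') a < r"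
    for v' w'
  proof -
    have line: "((\<lambda>s. c + s *\<^sub>R u) has_vector_derivative u) (at s)" for c u :: 'a and s
      by (auto simp: has_vector_derivative_def intro!: derivative_eq_intros)
    note D = has_real_derivative_along[OF line d1] and D2 = has_real_derivative_along[OF line d2]
    have inS: "a + s *\<^sub>R v' + s' *\<^sub>R w' \<in> S" if "0 \<le> s" "s \<le> t" "0 \<le> s'" "s' \<le> t" for s s'
      using nr[OF that] r(2) by blast
    \<comment> \<open>The second difference is the increment of \<open>k\<close> from 0 to
      \<open>t\<close>. The mean value theorem is applied to \<open>k\<close> in direction
      \<open>w'\<close>, then to \<open>dirderiv w' f\<close> in direction
      \<open>v'\<close>.\<close>
    define k where "k s = f ((a + t *\<^sub>R v') + s *\<^sub>R w') - f (a + s *\<^sub>R w')" for s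
    have "\<exists>s. 0 < s \<and> s < t \<and>
        k t - k 0 = (t - 0) * (dirderiv w' f ((a + t *\<^sub>R v') + s *\<^sub>R w') - dirderiv w' f (a + s *\<^sub>R w'))"
      unfolding k_def
    proof (rule MVT2[OF tpos])
      fix s assume "0 \<le> s" "s \<le> t"
      then show "((\<lambda>s. f ((a + t *\<^sub>R v') + s *\<^sub>R w') - f (a + s *\<^sub>R w')) has_real_derivative
          (dirderiv w' f ((a + t *\<^sub>R v') + s *\<^sub>R w') - dirderiv w' f (a + s *\<^sub>R w'))) (at s)"
        using inS[of t s] inS[of 0 s] tpos by (intro DERIV_diff D) auto
    qed
    then obtain s where s: "0 < s" "s < t"
      "k t - k 0 = t * (dirderiv w' f ((a + t *\<^sub>R v') + s *\<^sub>R w') - dirderiv w' f (a + s *\<^sub>R w'))" by auto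
    have "\<exists>s'. 0 < s' \<and> s' < t \<and>
        dirderiv w' f ((a + s *\<^sub>R w') + t *\<^sub>R v') - dirderiv w' f ((a + s *\<^sub>R w') + 0 *\<^sub>R v')
          = (t - 0) * dirderiv v' (dirderiv w' f) ((a + s *\<^sub>R w') + s' *\<^sub>R v')"
    proof (rule MVT2[OF tpos])
      fix s' assume "0 \<le> s'" "s' \<le> t"
      then show "((\<lambda>s'. dirderiv w' f ((a + s *\<^sub>R w') + s' *\<^sub>R v')) has_real_derivative
          dirderiv v' (dirderiv w' f) ((a + s *\<^sub>R w') + s' *\<^sub>R v')) (at s')"
        using inS[of s' s] s by (intro D2) (simp add: algebra_simps)
    qed
    then obtain s' where s': "0 < s'" "s' < t"
      "dirderiv w' f ((a + s *\<^sub>R w') + t *\<^sub>R v') - dirderiv w' f (a + s *\<^sub>R w')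
          = t * dirderiv v' (dirderiv w' f) ((a + s *\<^sub>R w') + s' *\<^sub>R v')" by auto
    have "k t - k 0 = t * t * dirderiv v' (dirderiv w' f) ((a + s *\<^sub>R w') + s' *\<^sub>R v')"
      using s(3) s'(3) by (simp add: algebra_simps)
    moreover have "dist ((a + s *\<^sub>R w') + s' *\<^sub>R v') a < r"
      using nr[of s' s] s s' by (simp add: algebra_simps)
    ultimately show ?thesis
      by (intro exI[of _ "(a + s *\<^sub>R w') + s' *\<^sub>R v'"]) (simp add: k_def)
  qed
  obtain b1 where b1: "dist b1 a < r" "f (a + t *\<^sub>R v + t *\<^sub>R w) - f (a + t *\<^sub>R v) - f (a + t *\<^sub>R w) + f a
      = t * t * A b1"
    using key[of v w] near unfolding A_def by blast
  obtain b2 where b2: "dist b2 a < r" "f (a + t *\<^sub>R w + t *\<^sub>R v) - f (a + t *\<^sub>R w) - f (a + t *\<^sub>R v) + f a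
      = t * t * B b2"
    using key[of w v] near unfolding B_def by (metis add.assoc add.commute)
  have "a + t *\<^sub>R v + t *\<^sub>R w = a + t *\<^sub>R w + t *\<^sub>R v" by simp
  then have "t * t * A b1 = t * t * B b2"
    using b1(2) b2(2) by (simp only:) 
  then have "A b1 = B b2" using tpos by simp
  then show False using r(2)[OF b1(1)] r(2)[OF b2(1)]
    unfolding e_def dist_real_def by (smt (verit) field_sum_of_halves)
qed

section \<open>Second derivatives along curves\<close>

lemma has_second_derivative_unique:
  assumes "has_second_derivative f m a" "has_second_derivative f m' a"
  shows "m = m'"
proof -
  from assms obtain f1 f2 where
    f: "\<forall>\<^sub>F t in nhds a. (f has_real_derivative f1 t) (at t)" "(f1 has_real_derivative m) (at a)"
       "\<forall>\<^sub>F t in nhds a. (f has_real_derivative f2 t) (at t)" "(f2 has_real_derivative m') (at a)"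
    by (auto simp: has_second_derivative_def)
  then have "\<forall>\<^sub>F t in nhds a. f1 t = f2 t"
    by (auto elim: eventually_elim2 intro: DERIV_unique)
  then have "(f1 has_real_derivative m') (at a)"
    using f(4) by (simp add: DERIV_cong_ev)
  with f(2) show ?thesis by (rule DERIV_unique)
qed

lemma has_second_derivative_cong:
  assumes "has_second_derivative f m a" "\<forall>\<^sub>F t in nhds a. f t = g t"
  shows "has_second_derivative g m a"
proof -
  from assms(1) obtain f1 where
    f: "\<forall>\<^sub>F t in nhds a. (f has_real_derivative f1 t) (at t)" "(f1 has_real_derivative m) (at a)"
    by (auto simp: has_second_derivative_def)
  \<comment> \<open>The derivative must exist at all \<open>t\<close> near \<open>a\<close>, so
    agreement is needed on a neighbourhood of each such \<open>t\<close>.\<close>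
  from assms(2) have "\<forall>\<^sub>F t in nhds a. \<forall>\<^sub>F s in nhds t. f s = g s"
    by (simp add: eventually_eventually)
  with f(1) have "\<forall>\<^sub>F t in nhds a. (g has_real_derivative f1 t) (at t)"
    by eventually_elim (simp add: DERIV_cong_ev)
  with f(2) show ?thesis by (auto simp: has_second_derivative_def)
qed

lemma has_second_derivative_add:
  assumes "has_second_derivative f m a" "has_second_derivative g n a"
  shows "has_second_derivative (\<lambda>t. f t + g t) (m + n) a"
proof -
  from assms obtain f1 f2 where
    f: "\<forall>\<^sub>F t in nhds a. (f has_real_derivative f1 t) (at t)" "(f1 has_real_derivative m) (at a)"
       "\<forall>\<^sub>F t in nhds a. (g has_real_derivative f2 t) (at t)" "(f2 has_real_derivative n) (at a)"
    by (auto simp: has_second_derivative_def)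
  have "\<forall>\<^sub>F t in nhds a. ((\<lambda>t. f t + g t) has_real_derivative f1 t + f2 t) (at t)"
    using f(1,3) by eventually_elim (rule DERIV_add)
  with DERIV_add[OF f(2,4)] show ?thesis
    unfolding has_second_derivative_def by (intro exI[of _ "\<lambda>t. f1 t + f2 t"]) simp
qed

text \<open>The value is D^2 f(\<gamma>', \<gamma>') + Df(\<gamma>''). The curve is only as regular
  as \<open>has_second_derivative\<close> itself requires: a velocity near \<open>t0\<close> that is
  differentiable at \<open>t0\<close>. This is all that will be known of the curve in
  \<open>Y\<close>.\<close>

lemma has_second_derivative_chain:
  fixes f :: "'a::euclidean_space \<Rightarrow> real" and \<gamma> \<gamma>' :: "real \<Rightarrow> 'a"
  assumes S: "open S" "Ck_on 2 S f" "\<gamma> t0 \<in> S"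
    and \<gamma>: "\<forall>\<^sub>F t in nhds t0. (\<gamma> has_vector_derivative \<gamma>' t) (at t)"
    and \<gamma>': "(\<gamma>' has_vector_derivative a) (at t0)"
  shows "has_second_derivative (\<lambda>t. f (\<gamma> t))
    (dirderiv (\<gamma>' t0) (dirderiv (\<gamma>' t0) f) (\<gamma> t0) + dirderiv a f (\<gamma> t0)) t0"
proof -
  have C2: "Ck_on (Suc (Suc 0)) S f"
    using S(2) by (simp only: numeral_2_eq_2)
  have d1: "f differentiable (at b)" if "b \<in> S" for b
    using C2 that by auto
  have d2: "dirderiv u f differentiable (at b)" if "b \<in> S" for u b
    using Ck_on_dirderiv[OF C2] that by auto
  have \<gamma>0: "(\<gamma> has_vector_derivative \<gamma>' t0) (at t0)"
    using \<gamma> by (rule eventually_nhds_x_imp_x)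
  then have "isCont \<gamma> t0"
    by (simp add: has_derivative_continuous has_vector_derivative_def)
  then have inS: "\<forall>\<^sub>F t in nhds t0. \<gamma> t \<in> S"
    using S by (metis isCont_def tendsto_at_iff_tendsto_nhds topological_tendstoD)
  \<comment> \<open>The direction \<open>\<gamma>' t\<close> moves with \<open>t\<close>. Expanding
    it in the basis leaves products of a coordinate of the velocity and a derivative in a fixed
    direction, to which the product rule applies.\<close>
  define f1 where "f1 t = (\<Sum>i\<in>Basis. (\<gamma>' t \<bullet> i) * dirderiv i f (\<gamma> t))" for t
  have lin: "dirderiv w f b = (\<Sum>i\<in>Basis. (w \<bullet> i) * dirderiv i f b)" if "b \<in> S" for w b
  proof -
    note l = linear_dirderiv[OF d1[OF that]]
    have "dirderiv w f b = dirderiv (\<Sum>i\<in>Basis. (w \<bullet> i) *\<^sub>R i) f b"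
      by (simp add: euclidean_representation)
    also have "\<dots> = (\<Sum>i\<in>Basis. (w \<bullet> i) * dirderiv i f b)"
      using l by (simp add: linear_sum[OF l] linear_cmul[OF l])
    finally show ?thesis .
  qed
  have "\<forall>\<^sub>F t in nhds t0. ((\<lambda>t. f (\<gamma> t)) has_real_derivative f1 t) (at t)"
    using \<gamma> inS
  proof eventually_elim
    case (elim t)
    then show ?case using has_real_derivative_along[OF elim(1) d1[OF elim(2)]] lin[OF elim(2), of "\<gamma>' t"]
      by (simp only: f1_def)
  qed
  moreover have "(f1 has_real_derivative
      dirderiv (\<gamma>' t0) (dirderiv (\<gamma>' t0) f) (\<gamma> t0) + dirderiv a f (\<gamma> t0)) (at t0)"
  proof -
    have "((\<lambda>t. (\<gamma>' t \<bullet> i) * dirderiv i f (\<gamma> t)) has_real_derivative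
        (a \<bullet> i) * dirderiv i f (\<gamma> t0) + (\<gamma>' t0 \<bullet> i) * dirderiv (\<gamma>' t0) (dirderiv i f) (\<gamma> t0)) (at t0)" for i
    proof -
      have "((\<lambda>t. \<gamma>' t \<bullet> i) has_real_derivative (a \<bullet> i)) (at t0)"
      proof -
        have "(\<lambda>x. x * (a \<bullet> i)) = (*) (a \<bullet> i)" by (simp add: fun_eq_iff)
        then show ?thesis
          using has_derivative_inner_left[OF \<gamma>'[unfolded has_vector_derivative_def], of i]
          by (simp add: has_field_derivative_def)
      qed
      from DERIV_mult[OF this has_real_derivative_along[OF \<gamma>0 d2[OF S(3)]]] show ?thesis
        by (simp add: mult.commute)
    qed
    then have "(f1 has_real_derivative (\<Sum>i\<in>Basis. (a \<bullet> i) * dirderiv i f (\<gamma> t0)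
        + (\<gamma>' t0 \<bullet> i) * dirderiv (\<gamma>' t0) (dirderiv i f) (\<gamma> t0))) (at t0)"
      unfolding f1_def[abs_def] by (intro DERIV_sum) 
    \<comment> \<open>Now the direction is frozen at \<open>\<gamma>' t0\<close>, so the expansion
      has constant coefficients and is differentiated termwise.\<close>
    moreover have "dirderiv (\<gamma>' t0) (dirderiv (\<gamma>' t0) f) (\<gamma> t0)
        = (\<Sum>i\<in>Basis. (\<gamma>' t0 \<bullet> i) * dirderiv (\<gamma>' t0) (dirderiv i f) (\<gamma> t0))"
    proof -
      have "((\<lambda>b. \<Sum>i\<in>Basis. (\<gamma>' t0 \<bullet> i) * dirderiv i f b) has_derivative
          (\<lambda>w. \<Sum>i\<in>Basis. (\<gamma>' t0 \<bullet> i) * dirderiv w (dirderiv i f) (\<gamma> t0))) (at (\<gamma> t0))"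
        using d2[OF S(3)] by (intro has_derivative_sum has_derivative_mult_right has_derivative_dirderiv)
      then have "(dirderiv (\<gamma>' t0) f has_derivative
          (\<lambda>w. \<Sum>i\<in>Basis. (\<gamma>' t0 \<bullet> i) * dirderiv w (dirderiv i f) (\<gamma> t0))) (at (\<gamma> t0))"
        by (rule has_derivative_transform_within_open[OF _ S(1,3)]) (rule lin[symmetric])
      then show ?thesis by (rule dirderiv_eq)
    qed
    ultimately show ?thesis by (simp only: sum.distrib lin[OF S(3), of a] add.commute)
  qed
  ultimately show ?thesis unfolding has_second_derivative_def by blast
qed

text \<open>Each point of \<open>K\<close> outside a neighbourhood \<open>U\<close> of
  \<open>l\<close> has a neighbourhood that \<open>f\<close> eventually avoids, and finitely many of
  these cover \<open>K - U\<close>. The product filter in \<open>sep\<close> allows this to be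
  checked by a limit taken jointly in \<open>t\<close> and in the candidate limit point.\<close>

lemma compact_tendsto_unique:
  fixes f :: "'a \<Rightarrow> 'b::topological_space"
  assumes "compact K" "\<forall>\<^sub>F t in F. f t \<in> K"
    and sep: "\<And>k. k \<in> K \<Longrightarrow> k \<noteq> l \<Longrightarrow> \<forall>\<^sub>F (t, k') in F \<times>\<^sub>F nhds k. f t \<noteq> k'"
  shows "(f \<longlongrightarrow> l) F"
proof (rule topological_tendstoI)
  fix U assume U: "open U" "l \<in> U"
  have "\<exists>V. open V \<and> k \<in> V \<and> (\<forall>\<^sub>F t in F. f t \<notin> V)" if k: "k \<in> K - U" for k
  proof -
    from sep[of k] k U obtain P Q where PQ: "eventually P F" "eventually Q (nhds k)"
      "\<And>t k'. P t \<Longrightarrow> Q k' \<Longrightarrow> f t \<noteq> k'"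
      unfolding eventually_prod_filter by blast
    from PQ(2) obtain V where "open V" "k \<in> V" "\<And>k'. k' \<in> V \<Longrightarrow> Q k'"
      unfolding eventually_nhds by auto
    with PQ(1,3) show ?thesis
      by (intro exI[of _ V]) (auto elim!: eventually_mono)
  qed
  then obtain V where V: "\<And>k. k \<in> K - U \<Longrightarrow> open (V k) \<and> k \<in> V k \<and> (\<forall>\<^sub>F t in F. f t \<notin> V k)"
    by metis
  have "compact (K - U)" using assms(1) U by (simp add: compact_diff)
  then obtain D where D: "D \<subseteq> K - U" "finite D" "K - U \<subseteq> (\<Union>k\<in>D. V k)"
    by (rule compactE_image[of _ "K - U" V]) (use V in auto)
  then have "\<forall>\<^sub>F t in F. \<forall>k\<in>D. f t \<notin> V k"
    using V by (intro eventually_ball_finite) auto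
  with assms(2) show "\<forall>\<^sub>F t in F. f t \<in> U"
    by eventually_elim (use D in auto)
qed

text \<open>The implicit function is given and continuous; only its derivative is sought, from
  differentiability of \<open>P\<close> at a single point. Since \<open>P\<close> vanishes along the
  graph, applying \<open>M'\<close> to its linearization gives the increment of \<open>f\<close> up
  to an error, whose part proportional to \<open>norm (f s - f a)\<close> is absorbed.\<close>

lemma implicit_has_derivative:
  fixes P :: "'a::real_normed_vector \<times> 'b::real_normed_vector \<Rightarrow> 'c::real_normed_vector"
  assumes P: "(P has_derivative (\<lambda>(h, k). A h + M k)) (at (a, f a))"
    and A: "bounded_linear A" and M': "bounded_linear M'" "\<And>k. M' (M k) = k"
    and f: "isCont f a" and zero: "\<forall>\<^sub>F s in nhds a. P (s, f s) = 0"
  shows "(f has_derivative (\<lambda>h. - M' (A h))) (at a)"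
proof -
  interpret M': bounded_linear M' by fact
  interpret M'A: bounded_linear "\<lambda>h. M' (A h)" using bounded_linear_compose[OF M'(1) A] .
  from M'.pos_bounded obtain C where C: "C > 0" "\<And>k. norm (M' k) \<le> norm k * C" by blast
  from M'A.pos_bounded obtain B where B: "B > 0" "\<And>k. norm (M' (A k)) \<le> norm k * B" by blast
  have Pa: "P (a, f a) = 0" using zero by (rule eventually_nhds_x_imp_x)
  show ?thesis unfolding has_derivative_at_alt
  proof (intro conjI allI impI)
    show "bounded_linear (\<lambda>h. - M' (A h))"
      using M'A.bounded_linear_axioms by (rule bounded_linear_minus)
    fix e :: real assume e: "e > 0"
    \<comment> \<open>The bound 1/2 on \<open>C * d\<close> allows the absorption, after which
      \<open>norm (s - a) + norm (f s - f a)\<close> is at most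
      \<open>(2 + 2 * B) * norm (s - a)\<close>. The other bound then makes the error at most
      \<open>e * norm (s - a)\<close>.\<close>
    define d where "d = min (1/2) (e / (2 + 2 * B)) / C"
    have d: "d > 0" "C * d \<le> 1/2" "C * d * (2 + 2 * B) \<le> e"
    proof -
      have CD: "C * d = min (1/2) (e / (2 + 2 * B))" using C(1) by (simp add: d_def)
      show "d > 0" using e B(1) C(1) by (auto simp: d_def)
      show "C * d \<le> 1/2" unfolding CD by (rule min.cobounded1)
      have "C * d * (2 + 2 * B) \<le> e / (2 + 2 * B) * (2 + 2 * B)"
        using B(1) by (intro mult_right_mono) (auto simp: CD)
      then show "C * d * (2 + 2 * B) \<le> e" using B(1) by simp
    qed
    from P[unfolded has_derivative_at_alt] d(1) obtain r where r: "r > 0"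
      "\<And>y. norm (y - (a, f a)) < r \<Longrightarrow>
        norm (P y - P (a, f a) - (case y - (a, f a) of (h, k) \<Rightarrow> A h + M k)) \<le> d * norm (y - (a, f a))"
      by blast
    have "((\<lambda>s. (s, f s)) \<longlongrightarrow> (a, f a)) (nhds a)"
      using f by (intro tendsto_Pair) (auto simp: tendsto_at_iff_tendsto_nhds isCont_def filterlim_ident)
    then have "\<forall>\<^sub>F s in nhds a. dist (s, f s) (a, f a) < r"
      using r(1) by (rule tendstoD)
    with zero have "\<forall>\<^sub>F s in nhds a. dist (s, f s) (a, f a) < r \<and> P (s, f s) = 0"
      by eventually_elim simp
    then obtain \<rho> where \<rho>: "\<rho> > 0"
      "\<And>s. dist s a < \<rho> \<Longrightarrow> dist (s, f s) (a, f a) < r \<and> P (s, f s) = 0"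
      by (auto simp: eventually_nhds_metric)
    have "norm (f s - f a - - M' (A (s - a))) \<le> e * norm (s - a)" if s: "norm (s - a) < \<rho>" for s
    proof -
      \<comment> \<open>The error of the claimed derivative. It is \<open>M'\<close> applied to the
        linear part of \<open>P\<close> at the increment, which equals minus the remainder of
        \<open>P\<close> because \<open>P\<close> is zero at both points.\<close>
      define \<phi> where "\<phi> = f s - f a + M' (A (s - a))"
      have *: "norm ((s, f s) - (a, f a)) < r" "P (s, f s) = 0"
        using \<rho>(2)[of s] s by (auto simp: dist_norm)
      have "\<phi> = M' (A (s - a) + M (f s - f a))"
        by (simp add: \<phi>_def M'.add M')
      then have "norm \<phi> \<le> C * norm (A (s - a) + M (f s - f a))"
        using C(2) by (simp add: mult.commute)
      also have "norm (A (s - a) + M (f s - f a)) \<le> d * norm ((s, f s) - (a, f a))"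
        using r(2)[OF *(1)] norm_minus_cancel[of "A (s - a) + M (f s - f a)"]
        by (simp only: *(2) Pa diff_Pair split_conv diff_0 diff_zero)
      also have "\<dots> \<le> d * (norm (s - a) + norm (f s - f a))"
        using d(1) norm_Pair_le[of "s - a" "f s - f a"] by simp
      finally have 1: "norm \<phi> \<le> C * d * (norm (s - a) + norm (f s - f a))"
        using C(1) by (simp add: mult.assoc)
      also have "\<dots> \<le> 1/2 * (norm (s - a) + norm (f s - f a))"
        using d(2) by (intro mult_right_mono) auto
      finally have 2: "norm \<phi> \<le> 1/2 * (norm (s - a) + norm (f s - f a))" .
      have "norm (f s - f a) \<le> norm \<phi> + norm (M' (A (s - a)))"
        using norm_triangle_ineq4[of \<phi> "M' (A (s - a))"] by (simp add: \<phi>_def)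
      with 2 B(2)[of "s - a"] have 3: "norm (f s - f a) \<le> (1 + 2 * B) * norm (s - a)"
        by (simp add: algebra_simps)
      have "norm \<phi> \<le> C * d * ((2 + 2 * B) * norm (s - a))"
        using 3 C(1) d(1) by (intro order_trans[OF 1] mult_left_mono) (auto simp: algebra_simps)
      also have "\<dots> \<le> e * norm (s - a)"
        using mult_right_mono[OF d(3), of "norm (s - a)"] by (simp add: mult.assoc)
      finally show ?thesis by (simp add: \<phi>_def)
    qed
    then show "\<exists>d>0. \<forall>y. norm (y - a) < d \<longrightarrow> norm (f y - f a - - M' (A (y - a))) \<le> e * norm (y - a)"
      using \<rho>(1) by blast
  qed
qed

section \<open>Matrices, scalar components and higher mixed derivatives\<close>

lemma matrix_inv_invertible:
  fixes M :: "real ^ 'n ^ 'n::finite"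
  assumes "invertible M"
  shows "M ** matrix_inv M = mat 1" "matrix_inv M ** M = mat 1"
proof -
  have "\<exists>A'. M ** A' = mat 1 \<and> A' ** M = mat 1"
    using assms by (simp add: invertible_def)
  then show "M ** matrix_inv M = mat 1" "matrix_inv M ** M = mat 1"
    unfolding matrix_inv_def by (metis (mono_tags, lifting) someI_ex)+
qed

lemma has_derivative_inner_all:
  fixes f :: "'a::real_normed_vector \<Rightarrow> 'b::euclidean_space"
  assumes "\<And>u. ((\<lambda>b. f b \<bullet> u) has_derivative (\<lambda>w. f' w \<bullet> u)) (at a)"
  shows "(f has_derivative f') (at a)"
  using assms by (simp add: has_derivative_componentwise_within[of f])

lemma has_derivative_cong_nhds:
  assumes "(f has_derivative f') (at a)" "\<forall>\<^sub>F b in nhds a. f b = g b"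
  shows "(g has_derivative f') (at a)"
proof (rule has_derivative_transform_eventually[OF assms(1)])
  show "\<forall>\<^sub>F b in at a. f b = g b"
    using assms(2) by (simp add: eventually_at_filter eventually_mono)
  show "f a = g a" using assms(2) by (rule eventually_nhds_x_imp_x)
qed simp

lemma grad_inner:
  fixes F :: "real ^ 'n::finite \<Rightarrow> real"
  assumes "F differentiable (at a)"
  shows "grad F a \<bullet> w = dirderiv w F a"
proof -
  note l = linear_dirderiv[OF assms]
  have "dirderiv w F a = dirderiv (\<Sum>i\<in>UNIV. (w $ i) *\<^sub>R axis i 1) F a"
    by (simp add: basis_expansion flip: scalar_mult_eq_scaleR)
  also have "\<dots> = grad F a \<bullet> w"
    by (simp add: linear_sum[OF l] linear_cmul[OF l] grad_def inner_vec_def mult.commute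
        flip: dirderiv_def)
  finally show ?thesis ..
qed

text \<open>Pairing with a fixed \<open>u\<close> replaces a vector field by scalar functions. In
  this way the matrices \<open>D11\<close>, \<open>D12\<close> and \<open>D22\<close> become
  iterated directional derivatives, to which symmetry applies.\<close>

lemma jacobian_inner:
  fixes \<Phi> :: "real ^ 'm::finite \<Rightarrow> real ^ 'n::finite"
  assumes S: "open S" "a \<in> S" and \<Phi>: "\<And>b u. b \<in> S \<Longrightarrow> \<Phi> b \<bullet> u = \<phi> u b"
    and \<phi>: "\<And>u. \<phi> u differentiable (at a)"
  shows "\<Phi> differentiable (at a)" "u \<bullet> (jacobian \<Phi> (at a) *v w) = dirderiv w (\<phi> u) a"
proof -
  have D: "((\<lambda>b. \<Phi> b \<bullet> u) has_derivative (\<lambda>w. dirderiv w (\<phi> u) a)) (at a)" for u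
    by (rule has_derivative_transform_within_open[OF has_derivative_dirderiv[OF \<phi>] S])
      (simp add: \<Phi>)
  show diff: "\<Phi> differentiable (at a)"
    using D by (subst differentiable_componentwise_within) (auto simp: differentiable_def)
  then have "(\<Phi> has_derivative (*v) (jacobian \<Phi> (at a))) (at a)"
    by (simp add: jacobian_works)
  then have "((\<lambda>b. \<Phi> b \<bullet> u) has_derivative (\<lambda>w. (jacobian \<Phi> (at a) *v w) \<bullet> u)) (at a)"
    by (rule has_derivative_inner_left)
  from has_derivative_unique[OF this D] show "u \<bullet> (jacobian \<Phi> (at a) *v w) = dirderiv w (\<phi> u) a"
    by (metis inner_commute)
qed

text \<open>Two swaps move \<open>a\<close> past both copies of \<open>v\<close>. The inner swap is
  an identity of functions on \<open>S\<close>, as it stands under a further derivative; the outer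
  one is an identity at \<open>b\<close>.\<close>

lemma dirderiv_commute3:
  fixes F :: "'a::real_normed_vector \<Rightarrow> real"
  assumes S: "open S" "b \<in> S" and F: "Ck_on (Suc (Suc (Suc 0))) S F"
  shows "dirderiv v (dirderiv v (dirderiv a F)) b = dirderiv a (dirderiv v (dirderiv v F)) b"
proof -
  have F2: "Ck_on 2 S F" using Ck_on_le[OF F, of 2] by simp
  have vF: "Ck_on 2 S (dirderiv v F)" using Ck_on_dirderiv[OF F] by (simp only: numeral_2_eq_2)
  have "dirderiv v (dirderiv a F) differentiable (at b)"
    using Ck_on_differentiable[OF Ck_on_dirderiv[OF Ck_on_dirderiv[OF F]]] S by blast
  then have "dirderiv v (dirderiv v (dirderiv a F)) b = dirderiv v (dirderiv a (dirderiv v F)) b"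
    by (intro dirderiv_cong[OF S]) (simp_all add: dirderiv_commute[OF S(1) F2])
  also have "\<dots> = dirderiv a (dirderiv v (dirderiv v F)) b"
    by (rule dirderiv_commute[OF S(1) vF S(2)])
  finally show ?thesis .
qed

text \<open>Each copy of \<open>u\<close> passes the pair \<open>v\<close>, \<open>v\<close> by the
  third-order case: one under an outer derivative, hence on all of \<open>S\<close>, the other at
  \<open>b\<close> for the function \<open>dirderiv u F\<close>.\<close>

lemma dirderiv_commute4:
  fixes F :: "'a::real_normed_vector \<Rightarrow> real"
  assumes S: "open S" "b \<in> S" and F: "Ck_on (Suc (Suc (Suc (Suc 0)))) S F"
  shows "dirderiv v (dirderiv v (dirderiv u (dirderiv u F))) b
    = dirderiv u (dirderiv u (dirderiv v (dirderiv v F))) b"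
proof -
  note uF = Ck_on_dirderiv[OF F, of u]
  have "dirderiv v (dirderiv v (dirderiv u F)) differentiable (at b)"
    using Ck_on_differentiable[OF Ck_on_dirderiv[OF Ck_on_dirderiv[OF uF]]] S by blast
  then have "dirderiv u (dirderiv v (dirderiv v (dirderiv u F))) b
      = dirderiv u (dirderiv u (dirderiv v (dirderiv v F))) b"
    by (intro dirderiv_cong[OF S]) (simp_all add: dirderiv_commute3[OF S(1) _ Ck_on_SucD[OF F]])
  then show ?thesis by (simp add: dirderiv_commute3[OF S uF])
qed

text \<open>The second derivative comes from the inverse function theorem for the tangent map
  \<open>(b, w) \<mapsto> (f b, Df(b) w)\<close>, which avoids differentiating the matrix inverse.\<close>

lemma inverse_curve_twice_differentiable:
  fixes f :: "'a::euclidean_space \<Rightarrow> 'a"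
  assumes S: "open S" "inj_on f S" and a: "a \<in> S" "f a = q"
    and f: "\<And>b. b \<in> S \<Longrightarrow> f differentiable (at b)"
    and f2: "\<And>b w. b \<in> S \<Longrightarrow> dirderiv w f differentiable (at b)"
    and N: "\<And>b. b \<in> S \<Longrightarrow> linear (N b)" "\<And>b w. b \<in> S \<Longrightarrow> dirderiv (N b w) f b = w"
      "\<And>b w. b \<in> S \<Longrightarrow> N b (dirderiv w f b) = w"
    and g: "\<And>b. b \<in> S \<Longrightarrow> g (f b) = b"
  obtains y' a' where "\<forall>\<^sub>F t in nhds 0. t *\<^sub>R p + q \<in> f ` S"
    "\<forall>\<^sub>F t in nhds 0. ((\<lambda>t. g (t *\<^sub>R p + q)) has_vector_derivative y' t) (at t)"
    "y' 0 = N a p" "(y' has_vector_derivative a') (at 0)"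
proof -
  have cont: "continuous_on S f"
    using f by (simp add: continuous_at_imp_continuous_on differentiable_imp_continuous_within)
  \<comment> \<open>Source and target have the same dimension, so continuity and injectivity make
    the image open; it then contains \<open>t *\<^sub>R p + q\<close> for small
    \<open>t\<close>.\<close>
  have "open (f ` S)" by (rule invariance_of_domain[OF cont S])
  have line: "((\<lambda>t. t *\<^sub>R p + q) has_derivative (\<lambda>t. t *\<^sub>R p)) (at t)" for t
    by (auto intro!: derivative_eq_intros)
  have "((\<lambda>t. t *\<^sub>R p + q) \<longlongrightarrow> 0 *\<^sub>R p + q) (nhds 0)"
    using has_derivative_continuous[OF line[of 0]] tendsto_at_iff_tendsto_nhds[of "\<lambda>t. t *\<^sub>R p + q" 0]
    by (simp add: isCont_def)
  from topological_tendstoD[OF this \<open>open (f ` S)\<close>]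
  have ev: "\<forall>\<^sub>F t in nhds 0. t *\<^sub>R p + q \<in> f ` S"
    using a by auto
  define fh where "fh = (\<lambda>(b, w). (f b, dirderiv w f b))"
  define gh where "gh = (\<lambda>(r, w). (g r, N (g r) w))"
  have fh: "(fh has_derivative (\<lambda>(h, k). (dirderiv h f b,
      dirderiv k f b + (\<Sum>i\<in>Basis. (w \<bullet> i) *\<^sub>R dirderiv h (dirderiv i f) b)))) (at (b, w))"
    if b: "b \<in> S" for b w
  proof -
    \<comment> \<open>Expanding \<open>w\<close> in the basis writes Df(b) w as a sum of products of
      a linear form in \<open>w\<close> and a derivative of \<open>f\<close> in a fixed direction,
      which can be differentiated in both variables.\<close>
    let ?D = "\<lambda>p. \<Sum>i\<in>Basis. (snd p \<bullet> i) *\<^sub>R dirderiv i f (fst p)"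
    have lin: "dirderiv k f b = (\<Sum>i\<in>Basis. (k \<bullet> i) *\<^sub>R dirderiv i f b)" if "b \<in> S" for b k
    proof -
      note l = linear_dirderiv[OF f[OF that]]
      have "dirderiv k f b = dirderiv (\<Sum>i\<in>Basis. (k \<bullet> i) *\<^sub>R i) f b"
        by (simp add: euclidean_representation)
      also have "\<dots> = (\<Sum>i\<in>Basis. (k \<bullet> i) *\<^sub>R dirderiv i f b)"
        by (simp add: linear_sum[OF l] linear_cmul[OF l])
      finally show ?thesis .
    qed
    have fstD: "(fst has_derivative fst) (at (b, w))" for b w :: 'a
      by (intro has_derivative_fst has_derivative_ident)
    have d1: "((\<lambda>p. f (fst p)) has_derivative (\<lambda>p. dirderiv (fst p) f b)) (at (b, w))"
      using has_derivative_compose[OF fstD, of f "\<lambda>h. dirderiv h f b"] has_derivative_dirderiv[OF f[OF b]]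
      by simp
    have d2: "((\<lambda>p. dirderiv i f (fst p)) has_derivative (\<lambda>p. dirderiv (fst p) (dirderiv i f) b)) (at (b, w))" for i
      using has_derivative_compose[OF fstD, of "dirderiv i f" "\<lambda>h. dirderiv h (dirderiv i f) b"]
        has_derivative_dirderiv[OF f2[OF b]] by simp
    have d3: "((\<lambda>p. snd p \<bullet> i) has_derivative (\<lambda>p. snd p \<bullet> i)) (at (b, w))" for i
      by (intro has_derivative_inner_left has_derivative_snd has_derivative_ident)
    have "(?D has_derivative (\<lambda>p. \<Sum>i\<in>Basis. (snd (b, w) \<bullet> i) *\<^sub>R dirderiv (fst p) (dirderiv i f) b
        + (snd p \<bullet> i) *\<^sub>R dirderiv i f (fst (b, w)))) (at (b, w))"
      by (intro has_derivative_sum has_derivative_scaleR d2 d3)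
    then have "((\<lambda>p. (f (fst p), ?D p)) has_derivative (\<lambda>p. (dirderiv (fst p) f b,
        dirderiv (snd p) f b + (\<Sum>i\<in>Basis. (w \<bullet> i) *\<^sub>R dirderiv (fst p) (dirderiv i f) b)))) (at (b, w))"
      using has_derivative_Pair[OF d1] by (simp add: sum.distrib lin[OF b, symmetric] add.commute)
    then show ?thesis unfolding case_prod_beta
    proof (rule has_derivative_transform_within_open[of _ _ _ _ "S \<times> UNIV"])
      show "open (S \<times> (UNIV :: 'a set))" using S(1) by (intro open_Times) auto
      show "(f (fst p), ?D p) = fh p" if "p \<in> S \<times> UNIV" for p
        using that lin[of "fst p" "snd p"] by (auto simp: fh_def case_prod_beta)
    qed (use b in auto)
  qed
  have gh: "gh differentiable (at (f b, dirderiv w f b))" if b: "b \<in> S" for b w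
  proof -
    \<comment> \<open>The derivative of \<open>fh\<close> is block triangular with off-diagonal
      block \<open>?E\<close>; \<open>?G\<close> inverts it by back substitution.\<close>
    let ?E = "\<lambda>h. \<Sum>i\<in>Basis. (w \<bullet> i) *\<^sub>R dirderiv h (dirderiv i f) b"
    let ?G = "\<lambda>(h, k). (N b h, N b (k - ?E (N b h)))"
    have "(gh has_derivative ?G) (at (fh (b, w)))"
    proof (rule has_derivative_inverse_strong[OF _ _ _ _ fh[OF b]])
      show "open (S \<times> (UNIV :: 'a set))" using S(1) by (intro open_Times) auto
      show "continuous_on (S \<times> (UNIV :: 'a set)) fh"
        using fh by (intro continuous_at_imp_continuous_on) (auto intro: has_derivative_continuous)
      show "gh (fh p) = p" if "p \<in> S \<times> UNIV" for p
        using that by (auto simp: gh_def fh_def g N)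
      show "(\<lambda>(h, k). (dirderiv h f b, dirderiv k f b + ?E h)) \<circ> ?G = id"
        using N(2)[OF b] by (auto simp: fun_eq_iff)
    qed (use b in auto)
    then show ?thesis by (auto simp: fh_def intro: differentiableI)
  qed
  \<comment> \<open>The velocity is N(g(tp + q)) p, the second component of \<open>gh\<close> at (tp
    + q, p). Differentiability of \<open>gh\<close> therefore gives the acceleration.\<close>
  define y' where "y' = (\<lambda>t. snd (gh (t *\<^sub>R p + q, p)))"
  have "((\<lambda>t. g (t *\<^sub>R p + q)) has_vector_derivative y' t) (at t)" if "t *\<^sub>R p + q \<in> f ` S" for t
  proof -
    from that obtain b where b: "b \<in> S" "t *\<^sub>R p + q = f b" by auto
    have gD: "(g has_derivative N b) (at (f b))"
      using N b(1) S g
      by (intro has_derivative_inverse_strong[OF S(1) b(1) cont _ has_derivative_dirderiv[OF f[OF b(1)]]])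
        (auto simp: fun_eq_iff)
    have "((\<lambda>t. g (t *\<^sub>R p + q)) has_derivative (\<lambda>t. N b (t *\<^sub>R p))) (at t)"
      using has_derivative_compose[OF line[of t], of g "N b"] gD b(2) by simp
    moreover have "N b (s *\<^sub>R p) = s *\<^sub>R y' t" for s
      using linear_cmul[OF N(1)[OF b(1)]] by (simp add: y'_def gh_def b g)
    ultimately show ?thesis by (simp add: has_vector_derivative_def)
  qed
  with ev have "\<forall>\<^sub>F t in nhds 0. ((\<lambda>t. g (t *\<^sub>R p + q)) has_vector_derivative y' t) (at t)"
    by (auto elim: eventually_mono)
  moreover have "y' 0 = N a p" using a g[OF a(1)] by (simp add: y'_def gh_def)
  moreover obtain a' where "(y' has_vector_derivative a') (at 0)"
  proof -
    \<comment> \<open>The point (q, p) is the value of \<open>fh\<close> at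
      \<open>(a, N a p)\<close>.\<close>
    have "gh differentiable (at (0 *\<^sub>R p + q, p))"
      using gh[OF a(1), of "N a p"] a by (simp add: N)
    then obtain G where G: "(gh has_derivative G) (at (0 *\<^sub>R p + q, p))" by (auto simp: differentiable_def)
    have "((\<lambda>t. (t *\<^sub>R p + q, p)) has_derivative (\<lambda>t. (t *\<^sub>R p, 0))) (at 0)"
      by (intro has_derivative_Pair line has_derivative_const)
    from has_derivative_snd[OF has_derivative_compose[OF this G]]
    have y'D: "(y' has_derivative (\<lambda>t. snd (G (t *\<^sub>R p, 0)))) (at 0)" by (simp add: y'_def)
    have "snd (G (t *\<^sub>R p, 0)) = t *\<^sub>R snd (G (1 *\<^sub>R p, 0))" for t
      using linear_cmul[OF has_derivative_linear[OF y'D], of t 1] by simp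
    with y'D have "(y' has_vector_derivative snd (G (1 *\<^sub>R p, 0))) (at 0)"
      by (simp add: has_vector_derivative_def)
    then show ?thesis by (rule that)
  qed
  ultimately show ?thesis using that ev by blast
qed

section \<open>Functions in local coordinates\<close>

definition is_chart :: "('m::topological_space, 'n::finite) chart \<Rightarrow> bool" where
  "is_chart c \<longleftrightarrow> open (fst c) \<and> open (snd c ` fst c) \<and>
     homeomorphism (fst c) (snd c ` fst c) (snd c) (chart_inv c)"

lemma smooth_atlas_chart: "smooth_atlas A \<Longrightarrow> c \<in> charts_at A x \<Longrightarrow> is_chart c \<and> x \<in> fst c"
  by (simp add: smooth_atlas_def is_chart_def charts_at_def)

lemma smooth_atlas_ex_chart: "smooth_atlas A \<Longrightarrow> \<exists>c. c \<in> charts_at A x"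
  unfolding smooth_atlas_def charts_at_def by blast

lemma chart_inv_left: "is_chart c \<Longrightarrow> x \<in> fst c \<Longrightarrow> chart_inv c (snd c x) = x"
  by (simp add: is_chart_def homeomorphism_def)

lemma chart_inv_right: "is_chart c \<Longrightarrow> \<xi> \<in> snd c ` fst c \<Longrightarrow> snd c (chart_inv c \<xi>) = \<xi>"
  by (auto simp: is_chart_def homeomorphism_def)

lemma isCont_chart: "is_chart c \<Longrightarrow> x \<in> fst c \<Longrightarrow> isCont (snd c) x"
  using continuous_on_eq_continuous_at[of "fst c" "snd c"] by (simp add: is_chart_def homeomorphism_def)

lemma isCont_chart_inv: "is_chart c \<Longrightarrow> \<xi> \<in> snd c ` fst c \<Longrightarrow> isCont (chart_inv c) \<xi>"
  using continuous_on_eq_continuous_at[of "snd c ` fst c" "chart_inv c"]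
  unfolding is_chart_def homeomorphism_def by blast

definition chart_rep :: "('m, 'n::finite) chart \<Rightarrow> ('k, 'n) chart \<Rightarrow> ('m \<Rightarrow> 'k \<Rightarrow> real)
    \<Rightarrow> (real ^ 'n) \<times> (real ^ 'n) \<Rightarrow> real" where
  "chart_rep c d f = (\<lambda>(\<xi>, \<zeta>). f (chart_inv c \<xi>) (chart_inv d \<zeta>))"

text \<open>\<open>chart_inv\<close> is an \<open>inv_into\<close> and is meaningful only on the
  range of its chart, so \<open>V\<close> is kept inside the product of the two ranges.\<close>

definition Ck_rep :: "nat \<Rightarrow> ('m::topological_space, 'n::finite) chart \<Rightarrow> ('k::topological_space, 'n) chart
    \<Rightarrow> ('m \<Rightarrow> 'k \<Rightarrow> real) \<Rightarrow> ((real ^ 'n) \<times> (real ^ 'n)) set \<Rightarrow> bool" where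
  "Ck_rep k c d f V \<longleftrightarrow> is_chart c \<and> is_chart d \<and> open V \<and> V \<subseteq> snd c ` fst c \<times> snd d ` fst d \<and>
     Ck_on k V (chart_rep c d f)"

lemma Ck_prod_Ck_rep:
  assumes A: "smooth_atlas A" and B: "smooth_atlas B" and f: "Ck_prod A B k S f" and xy: "(x, y) \<in> S"
    and c: "c \<in> charts_at A x" and d: "d \<in> charts_at B y"
  obtains V where "Ck_rep k c d f V" "(snd c x, snd d y) \<in> V"
proof -
  note c' = smooth_atlas_chart[OF A c] and d' = smooth_atlas_chart[OF B d]
  from f obtain W where W: "open W" "S \<subseteq> W"
    "Ck_on k (map_prod (snd c) (snd d) ` (W \<inter> fst c \<times> fst d))
             (\<lambda>(\<xi>, \<zeta>). f (chart_inv c \<xi>) (chart_inv d \<zeta>))"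
    unfolding Ck_prod_def using c d by (auto simp: charts_at_def)
  define V where "V = map_prod (snd c) (snd d) ` (W \<inter> fst c \<times> fst d)"
  \<comment> \<open>The image of \<open>W\<close> under the charts is rewritten as a preimage under
    the inverse charts, whose continuity then makes it open.\<close>
  have "V = (snd c ` fst c \<times> snd d ` fst d) \<inter> (\<lambda>p. (chart_inv c (fst p), chart_inv d (snd p))) -` W"
  proof (intro equalityI subsetI)
    fix p assume "p \<in> V"
    then obtain x y where "(x, y) \<in> W" "x \<in> fst c" "y \<in> fst d" "p = (snd c x, snd d y)"
      by (auto simp: V_def)
    then show "p \<in> (snd c ` fst c \<times> snd d ` fst d) \<inter> (\<lambda>p. (chart_inv c (fst p), chart_inv d (snd p))) -` W"
      using c' d' by (simp add: chart_inv_left)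
  next
    fix p assume "p \<in> (snd c ` fst c \<times> snd d ` fst d) \<inter> (\<lambda>p. (chart_inv c (fst p), chart_inv d (snd p))) -` W"
    then obtain x y where "x \<in> fst c" "y \<in> fst d" "p = (snd c x, snd d y)"
      "(chart_inv c (snd c x), chart_inv d (snd d y)) \<in> W" by auto
    then show "p \<in> V"
      using c' d' unfolding V_def by (intro image_eqI[of _ _ "(x, y)"]) (auto simp: chart_inv_left)
  qed
  moreover have "open \<dots>"
  proof (rule continuous_open_preimage)
    have cont: "continuous_on (snd c ` fst c) (chart_inv c)" "continuous_on (snd d ` fst d) (chart_inv d)"
      and op: "open (snd c ` fst c)" "open (snd d ` fst d)"
      using c' d' by (auto simp: is_chart_def homeomorphism_def)
    let ?R = "snd c ` fst c \<times> snd d ` fst d"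
    have "continuous_on ?R (\<lambda>p. chart_inv c (fst p))" "continuous_on ?R (\<lambda>p. chart_inv d (snd p))"
      by (rule continuous_on_compose2[OF cont(1) continuous_on_fst[OF continuous_on_id]]
          continuous_on_compose2[OF cont(2) continuous_on_snd[OF continuous_on_id]]; force)+
    then show "continuous_on ?R (\<lambda>p. (chart_inv c (fst p), chart_inv d (snd p)))"
      by (rule continuous_on_Pair)
    show "open ?R" using op by (rule open_Times)
  qed (rule W)
  ultimately have "open V" by simp
  moreover have "V \<subseteq> snd c ` fst c \<times> snd d ` fst d" unfolding V_def by auto
  moreover have "Ck_on k V (chart_rep c d f)" using W(3) by (simp only: V_def chart_rep_def)
  ultimately have "Ck_rep k c d f V"
    using c' d' by (simp add: Ck_rep_def)
  moreover have "(snd c x, snd d y) \<in> V"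
    using c' d' W(2) xy unfolding V_def by (intro image_eqI[of _ _ "(x, y)"]) auto
  ultimately show ?thesis by (rule that)
qed

lemma Ck_rep_le: "Ck_rep k c d f V \<Longrightarrow> j \<le> k \<Longrightarrow> Ck_rep j c d f V"
  unfolding Ck_rep_def using Ck_on_le by blast

lemma Ck_rep_differentiable:
  "Ck_rep k c d f V \<Longrightarrow> k > 0 \<Longrightarrow> p \<in> V \<Longrightarrow> chart_rep c d f differentiable (at p)"
  unfolding Ck_rep_def using Ck_on_differentiable by blast

lemma Ck_rep_differentiable2:
  assumes "Ck_rep 2 c d f V" "p \<in> V"
  shows "dirderiv w (chart_rep c d f) differentiable (at p)"
proof -
  have "Ck_on (Suc (Suc 0)) V (chart_rep c d f)"
    using assms by (simp only: Ck_rep_def numeral_2_eq_2)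
  from Ck_on_dirderiv[OF this] show ?thesis using assms(2) by auto
qed

section \<open>Partial derivatives in charts as directional derivatives of the
  representative\<close>

lemma has_derivative_partial1:
  assumes "F differentiable (at (a, b))"
  shows "((\<lambda>\<xi>. F (\<xi>, b)) has_derivative (\<lambda>w. dirderiv (w, 0) F (a, b))) (at a)"
proof -
  have "((\<lambda>\<xi>. (\<xi>, b)) has_derivative (\<lambda>w. (w, 0))) (at a)"
    by (auto intro!: derivative_eq_intros)
  from has_derivative_compose[OF this has_derivative_dirderiv[OF assms]] show ?thesis .
qed

lemma has_derivative_partial2:
  assumes "F differentiable (at (a, b))"
  shows "((\<lambda>\<zeta>. F (a, \<zeta>)) has_derivative (\<lambda>w. dirderiv (0, w) F (a, b))) (at b)"
proof -
  have "((\<lambda>\<zeta>. (a, \<zeta>)) has_derivative (\<lambda>w. (0, w))) (at b)"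
    by (auto intro!: derivative_eq_intros)
  from has_derivative_compose[OF this has_derivative_dirderiv[OF assms]] show ?thesis .
qed

lemma Ck_rep_charts:
  assumes "Ck_rep k c d f V" "(\<xi>, \<zeta>) \<in> V"
  shows "is_chart c" "is_chart d" "snd c (chart_inv c \<xi>) = \<xi>" "snd d (chart_inv d \<zeta>) = \<zeta>"
    "\<xi> \<in> snd c ` fst c" "\<zeta> \<in> snd d ` fst d"
proof -
  show c: "is_chart c" "is_chart d" and im: "\<xi> \<in> snd c ` fst c" "\<zeta> \<in> snd d ` fst d"
    using assms unfolding Ck_rep_def by blast+
  then show "snd c (chart_inv c \<xi>) = \<xi>" "snd d (chart_inv d \<zeta>) = \<zeta>"
    by (simp_all add: chart_inv_right)
qed

lemma D1_rep:
  assumes "Ck_rep k c d f V" "k > 0" "(\<xi>, \<zeta>) \<in> V"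
  shows "D1 c f (chart_inv c \<xi>) (chart_inv d \<zeta>) \<bullet> w = dirderiv (w, 0) (chart_rep c d f) (\<xi>, \<zeta>)"
proof -
  have D: "((\<lambda>\<xi>. f (chart_inv c \<xi>) (chart_inv d \<zeta>)) has_derivative
      (\<lambda>w. dirderiv (w, 0) (chart_rep c d f) (\<xi>, \<zeta>))) (at \<xi>)"
    using has_derivative_partial1[OF Ck_rep_differentiable[OF assms]] by (simp add: chart_rep_def)
  have "D1 c f (chart_inv c \<xi>) (chart_inv d \<zeta>) = grad (\<lambda>\<xi>. f (chart_inv c \<xi>) (chart_inv d \<zeta>)) \<xi>"
    by (simp add: D1_def Ck_rep_charts[OF assms(1,3)])
  then show ?thesis
    using grad_inner[of _ \<xi>] differentiableI[OF D] dirderiv_eq[OF D] by metis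
qed

lemma D2_rep:
  assumes "Ck_rep k c d f V" "k > 0" "(\<xi>, \<zeta>) \<in> V"
  shows "D2 d f (chart_inv c \<xi>) (chart_inv d \<zeta>) \<bullet> w = dirderiv (0, w) (chart_rep c d f) (\<xi>, \<zeta>)"
proof -
  have D: "((\<lambda>\<zeta>. f (chart_inv c \<xi>) (chart_inv d \<zeta>)) has_derivative
      (\<lambda>w. dirderiv (0, w) (chart_rep c d f) (\<xi>, \<zeta>))) (at \<zeta>)"
    using has_derivative_partial2[OF Ck_rep_differentiable[OF assms]] by (simp add: chart_rep_def)
  have "D2 d f (chart_inv c \<xi>) (chart_inv d \<zeta>) = grad (\<lambda>\<zeta>. f (chart_inv c \<xi>) (chart_inv d \<zeta>)) \<zeta>"
    by (simp add: D2_def Ck_rep_charts[OF assms(1,3)])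
  then show ?thesis
    using grad_inner[of _ \<zeta>] differentiableI[OF D] dirderiv_eq[OF D] by metis
qed

lemma open_slice1: "open V \<Longrightarrow> open {\<xi>. (\<xi>, \<zeta>) \<in> V}"
  by (rule open_vimage[of V "\<lambda>\<xi>. (\<xi>, \<zeta>)", unfolded vimage_def]) (assumption, intro continuous_on_Pair continuous_on_id continuous_on_const)

lemma open_slice2: "open V \<Longrightarrow> open {\<zeta>. (\<xi>, \<zeta>) \<in> V}"
  by (rule open_vimage[of V "\<lambda>\<zeta>. (\<xi>, \<zeta>)", unfolded vimage_def]) (assumption, intro continuous_on_Pair continuous_on_id continuous_on_const)

lemma D11_rep:
  assumes "Ck_rep 2 c d f V" "(\<xi>, \<zeta>) \<in> V"
  shows "u \<bullet> (D11 c f (chart_inv c \<xi>) (chart_inv d \<zeta>) *v w)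
    = dirderiv (w, 0) (dirderiv (u, 0) (chart_rep c d f)) (\<xi>, \<zeta>)"
proof -
  let ?S = "{\<xi>. (\<xi>, \<zeta>) \<in> V}"
  note D = has_derivative_partial1[OF Ck_rep_differentiable2[OF assms]]
  have "u \<bullet> (jacobian (\<lambda>\<xi>. D1 c f (chart_inv c \<xi>) (chart_inv d \<zeta>)) (at \<xi>) *v w)
      = dirderiv w (\<lambda>\<xi>. dirderiv (u, 0) (chart_rep c d f) (\<xi>, \<zeta>)) \<xi>"
  proof (rule jacobian_inner(2)[where S = ?S and \<phi> = "\<lambda>u \<xi>. dirderiv (u, 0) (chart_rep c d f) (\<xi>, \<zeta>)"])
    show "open ?S" using assms(1) by (auto simp: Ck_rep_def intro: open_slice1)
  qed (use assms(2) D1_rep[OF assms(1)] D2_rep[OF assms(1)] D[THEN differentiableI] in simp_all)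
  then show ?thesis
    by (simp add: D11_def Ck_rep_charts[OF assms] dirderiv_eq[OF D])
qed

lemma D12_rep:
  assumes "Ck_rep 2 c d f V" "(\<xi>, \<zeta>) \<in> V"
  shows "u \<bullet> (D12 c d f (chart_inv c \<xi>) (chart_inv d \<zeta>) *v w)
    = dirderiv (0, w) (dirderiv (u, 0) (chart_rep c d f)) (\<xi>, \<zeta>)"
    and "(\<lambda>\<zeta>. D1 c f (chart_inv c \<xi>) (chart_inv d \<zeta>)) differentiable (at \<zeta>)"
proof -
  let ?S = "{\<zeta>. (\<xi>, \<zeta>) \<in> V}"
  note D = has_derivative_partial2[OF Ck_rep_differentiable2[OF assms]]
  have "u \<bullet> (jacobian (\<lambda>\<zeta>. D1 c f (chart_inv c \<xi>) (chart_inv d \<zeta>)) (at \<zeta>) *v w)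
      = dirderiv w (\<lambda>\<zeta>. dirderiv (u, 0) (chart_rep c d f) (\<xi>, \<zeta>)) \<zeta>"
  proof (rule jacobian_inner(2)[where S = ?S and \<phi> = "\<lambda>u \<zeta>. dirderiv (u, 0) (chart_rep c d f) (\<xi>, \<zeta>)"])
    show "open ?S" using assms(1) by (auto simp: Ck_rep_def intro: open_slice2)
  qed (use assms(2) D1_rep[OF assms(1)] D2_rep[OF assms(1)] D[THEN differentiableI] in simp_all)
  then show "u \<bullet> (D12 c d f (chart_inv c \<xi>) (chart_inv d \<zeta>) *v w)
    = dirderiv (0, w) (dirderiv (u, 0) (chart_rep c d f)) (\<xi>, \<zeta>)"
    by (simp add: D12_def Ck_rep_charts[OF assms] dirderiv_eq[OF D])
  show "(\<lambda>\<zeta>. D1 c f (chart_inv c \<xi>) (chart_inv d \<zeta>)) differentiable (at \<zeta>)"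
  proof (rule jacobian_inner(1)[where S = ?S and \<phi> = "\<lambda>u \<zeta>. dirderiv (u, 0) (chart_rep c d f) (\<xi>, \<zeta>)"])
    show "open ?S" using assms(1) by (auto simp: Ck_rep_def intro: open_slice2)
  qed (use assms(2) D1_rep[OF assms(1)] D[THEN differentiableI] in simp_all)
qed

lemma D22_rep:
  assumes "Ck_rep 2 c d f V" "(\<xi>, \<zeta>) \<in> V"
  shows "u \<bullet> (D22 d f (chart_inv c \<xi>) (chart_inv d \<zeta>) *v w)
    = dirderiv (0, w) (dirderiv (0, u) (chart_rep c d f)) (\<xi>, \<zeta>)"
proof -
  let ?S = "{\<zeta>. (\<xi>, \<zeta>) \<in> V}"
  note D = has_derivative_partial2[OF Ck_rep_differentiable2[OF assms]]
  have "u \<bullet> (jacobian (\<lambda>\<zeta>. D2 d f (chart_inv c \<xi>) (chart_inv d \<zeta>)) (at \<zeta>) *v w)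
      = dirderiv w (\<lambda>\<zeta>. dirderiv (0, u) (chart_rep c d f) (\<xi>, \<zeta>)) \<zeta>"
  proof (rule jacobian_inner(2)[where S = ?S and \<phi> = "\<lambda>u \<zeta>. dirderiv (0, u) (chart_rep c d f) (\<xi>, \<zeta>)"])
    show "open ?S" using assms(1) by (auto simp: Ck_rep_def intro: open_slice2)
  qed (use assms(2) D1_rep[OF assms(1)] D2_rep[OF assms(1)] D[THEN differentiableI] in simp_all)
  then show ?thesis
    by (simp add: D22_def Ck_rep_charts[OF assms] dirderiv_eq[OF D])
qed

text \<open>Joint continuity of the first derivative, for an arbitrary filter because the
  compactness argument uses it along a product filter. The chart \<open>c\<close> at the limit point
  also serves at nearby points, since its domain is open.\<close>

lemma tendsto_D1:
  assumes A: "smooth_atlas A" and B: "smooth_atlas B"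
    and f: "Ck_prod A B 2 S f" "(x, y) \<in> S" and c: "c \<in> charts_at A x"
    and X: "(X \<longlongrightarrow> x) F" and Y: "(Y \<longlongrightarrow> y) F"
  shows "((\<lambda>t. D1 c f (X t) (Y t)) \<longlongrightarrow> D1 c f x y) F"
proof -
  obtain d where d: "d \<in> charts_at B y" using smooth_atlas_ex_chart[OF B] by blast
  note c' = smooth_atlas_chart[OF A c] and d' = smooth_atlas_chart[OF B d]
  obtain V where V: "Ck_rep 2 c d f V" "(snd c x, snd d y) \<in> V"
    using Ck_prod_Ck_rep[OF A B f c d] .
  have XY: "((\<lambda>t. (snd c (X t), snd d (Y t))) \<longlongrightarrow> (snd c x, snd d y)) F"
    using isCont_chart[of c x] isCont_chart[of d y] c' d' X Y
    by (intro tendsto_Pair) (auto intro: isCont_tendsto_compose)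
  have ev: "\<forall>\<^sub>F t in F. X t \<in> fst c \<and> Y t \<in> fst d \<and> (snd c (X t), snd d (Y t)) \<in> V"
    using topological_tendstoD[OF X, of "fst c"] topological_tendstoD[OF Y, of "fst d"]
      topological_tendstoD[OF XY, of V] c' d' V by (auto simp: eventually_conj_iff is_chart_def Ck_rep_def)
  have "((\<lambda>t. D1 c f (X t) (Y t) \<bullet> w) \<longlongrightarrow> D1 c f x y \<bullet> w) F" for w
  proof (rule Lim_transform_eventually)
    have "isCont (dirderiv (w, 0) (chart_rep c d f)) (snd c x, snd d y)"
      using Ck_rep_differentiable2[OF V] by (rule differentiable_imp_continuous_within)
    from isCont_tendsto_compose[OF this XY]
    show "((\<lambda>t. dirderiv (w, 0) (chart_rep c d f) (snd c (X t), snd d (Y t))) \<longlongrightarrow> D1 c f x y \<bullet> w) F"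
      using D1_rep[OF V(1) _ V(2), of w] c' d' by (simp add: chart_inv_left)
    show "\<forall>\<^sub>F t in F. dirderiv (w, 0) (chart_rep c d f) (snd c (X t), snd d (Y t)) = D1 c f (X t) (Y t) \<bullet> w"
      using ev
    proof eventually_elim
      case (elim t)
      then show ?case
        using D1_rep[OF V(1), of "snd c (X t)" "snd d (Y t)" w] c' d' by (simp add: chart_inv_left)
    qed
  qed
  then show ?thesis by (subst tendsto_componentwise_iff) simp
qed

section \<open>Curves and first derivatives in a chart\<close>

lemma smooth_curveE:
  fixes A :: "('m::topological_space, 'n::finite) chart set"
  assumes \<beta>: "smooth_curve_through A X c x v \<beta>" and c: "c \<in> charts_at A x" "is_chart c"
  obtains \<gamma>' a where "\<forall>\<^sub>F s in nhds 0. \<beta> s \<in> X \<and> \<beta> s \<in> fst c"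
    "\<forall>\<^sub>F s in nhds 0. ((\<lambda>s. snd c (\<beta> s)) has_vector_derivative \<gamma>' s) (at s)"
    "\<gamma>' 0 = v" "(\<gamma>' has_vector_derivative a) (at 0)"
proof -
  from \<beta> c(1) obtain J where J: "open J" "0 \<in> J" "\<beta> ` J \<subseteq> X" "continuous_on J \<beta>"
    "\<And>k. Ck_on k {s \<in> J. \<beta> s \<in> fst c} (\<lambda>s. snd c (\<beta> s))"
    and \<beta>0: "\<beta> 0 = x" "((\<lambda>s. snd c (\<beta> s)) has_vector_derivative v) (at 0)"
    unfolding smooth_curve_through_def charts_at_def by auto
  define S where "S = {s \<in> J. \<beta> s \<in> fst c}"
  have "S = J \<inter> \<beta> -` fst c" by (auto simp: S_def)
  then have S: "open S" "0 \<in> S"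
    using J c \<beta>0 continuous_open_preimage[OF J(4,1), of "fst c"]
    by (auto simp: is_chart_def charts_at_def)
  define \<gamma> where "\<gamma> = (\<lambda>s. snd c (\<beta> s))"
  have C: "Ck_on (Suc (Suc 0)) S \<gamma>" using J(5) unfolding S_def \<gamma>_def by blast
  \<comment> \<open>A linear map on the reals is determined by its value at 1, so velocity and
    acceleration are the first and second iterates of \<open>dirderiv 1\<close>.\<close>
  have vd: "(F has_vector_derivative dirderiv 1 F s) (at s)" if "F differentiable (at s)"
    for F :: "real \<Rightarrow> real ^ 'n" and s
  proof -
    have "(\<lambda>h. dirderiv h F s) = (\<lambda>h. h *\<^sub>R dirderiv 1 F s)"
    proof
      fix h show "dirderiv h F s = h *\<^sub>R dirderiv 1 F s"
        using linear_cmul[OF linear_dirderiv[OF that], of h 1] by simp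
    qed
    with has_derivative_dirderiv[OF that] show ?thesis
      by (simp only: has_vector_derivative_def)
  qed
  show ?thesis
  proof (rule that)
    have evS: "\<forall>\<^sub>F s in nhds 0. s \<in> S" using S by (metis eventually_nhds)
    then show "\<forall>\<^sub>F s in nhds 0. \<beta> s \<in> X \<and> \<beta> s \<in> fst c"
      by eventually_elim (use J in \<open>auto simp: S_def\<close>)
    from evS show "\<forall>\<^sub>F s in nhds 0. ((\<lambda>s. snd c (\<beta> s)) has_vector_derivative dirderiv 1 \<gamma> s) (at s)"
      by eventually_elim (use C vd[of \<gamma>] in \<open>simp add: \<gamma>_def\<close>)
    show "dirderiv 1 \<gamma> 0 = v"
      using \<beta>0(2) dirderiv_eq[of \<gamma> "\<lambda>t. t *\<^sub>R v" 0 1] by (simp add: has_vector_derivative_def \<gamma>_def)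
    show "(dirderiv 1 \<gamma> has_vector_derivative dirderiv 1 (dirderiv 1 \<gamma>) 0) (at 0)"
      using Ck_on_dirderiv[OF C] S(2) by (intro vd) auto
  qed
qed

lemma open_chart_image:
  assumes "is_chart c" "open U"
  shows "open (snd c ` (U \<inter> fst c))"
proof -
  have "snd c ` (U \<inter> fst c) = snd c ` fst c \<inter> chart_inv c -` U"
    using chart_inv_left[OF assms(1)] by auto
  moreover have "open \<dots>"
    using assms by (intro continuous_open_preimage) (auto simp: is_chart_def homeomorphism_def)
  ultimately show ?thesis by simp
qed

lemma D1_has_derivative:
  assumes A: "smooth_atlas A" and B: "smooth_atlas B"
    and f: "Ck_prod A B 2 S f" "(x, y) \<in> S" and c: "c \<in> charts_at A x"
  shows "((\<lambda>\<xi>. f (chart_inv c \<xi>) y) has_derivative (\<lambda>w. D1 c f x y \<bullet> w)) (at (snd c x))"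
proof -
  obtain d where d: "d \<in> charts_at B y" using smooth_atlas_ex_chart[OF B] by blast
  note c' = smooth_atlas_chart[OF A c] and d' = smooth_atlas_chart[OF B d]
  obtain V where V: "Ck_rep 2 c d f V" "(snd c x, snd d y) \<in> V"
    using Ck_prod_Ck_rep[OF A B f c d] .
  show ?thesis
    using has_derivative_partial1[OF Ck_rep_differentiable[OF V(1) _ V(2)]] D1_rep[OF V(1) _ V(2)] c' d'
    by (simp add: chart_rep_def chart_inv_left)
qed

lemma D2_has_derivative:
  assumes A: "smooth_atlas A" and B: "smooth_atlas B"
    and f: "Ck_prod A B 2 S f" "(x, y) \<in> S" and d: "d \<in> charts_at B y"
  shows "((\<lambda>\<zeta>. f x (chart_inv d \<zeta>)) has_derivative (\<lambda>w. D2 d f x y \<bullet> w)) (at (snd d y))"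
proof -
  obtain c where c: "c \<in> charts_at A x" using smooth_atlas_ex_chart[OF A] by blast
  note c' = smooth_atlas_chart[OF A c] and d' = smooth_atlas_chart[OF B d]
  obtain V where V: "Ck_rep 2 c d f V" "(snd c x, snd d y) \<in> V"
    using Ck_prod_Ck_rep[OF A B f c d] .
  show ?thesis
    using has_derivative_partial2[OF Ck_rep_differentiable[OF V(1) _ V(2)]] D2_rep[OF V(1) _ V(2)] c' d'
    by (simp add: chart_rep_def chart_inv_left)
qed

lemma Ck_prod_le:
  assumes "Ck_prod A B k S f" "j \<le> k"
  shows "Ck_prod A B j S f"
proof -
  from assms(1) obtain W where W: "open W" "S \<subseteq> W" "\<forall>c\<in>A. \<forall>d\<in>B.
      Ck_on k (map_prod (snd c) (snd d) ` (W \<inter> fst c \<times> fst d))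
        (\<lambda>(\<xi>, \<zeta>). f (chart_inv c \<xi>) (chart_inv d \<zeta>))"
    unfolding Ck_prod_def by (elim exE conjE)
  show ?thesis
    unfolding Ck_prod_def
    by (intro exI[of _ W] conjI ballI W Ck_on_le[OF W(3)[rule_format] assms(2)])
qed

section \<open>Costs given by a supremum\<close>

locale sup_cost =
  fixes AX :: "('mx::{t2_space,second_countable_topology}, 'n::finite) chart set"
    and AY :: "('my::{t2_space,second_countable_topology}, 'n) chart set"
    and AZ :: "('mz::{t2_space,second_countable_topology}, 'n) chart set"
    and X :: "'mx set" and Y :: "'my set" and Z :: "'mz set"
    and h :: "'mx \<Rightarrow> 'mz \<Rightarrow> real" and g :: "'my \<Rightarrow> 'mz \<Rightarrow> real" and b :: "'mx \<Rightarrow> 'my \<Rightarrow> real"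
  assumes manifolds: "smooth_atlas AX" "smooth_atlas AY" "smooth_atlas AZ"
    and opens: "open X" "open Y" "open Z"
    and compact_Z: "compact (closure Z)"
    and h_C2: "Ck_prod AX AZ 2 (closure X \<times> closure Z) h"
    and g_C2: "Ck_prod AY AZ 2 (closure Y \<times> closure Z) g"
    and b_sup: "\<And>x y. x \<in> closure X \<Longrightarrow> y \<in> closure Y \<Longrightarrow> b x y = (SUP z\<in>Z. h x z + g y z)"
    and unique_max: "\<And>x y. x \<in> X \<Longrightarrow> y \<in> Y \<Longrightarrow> \<exists>!z. is_maximizer Z h g x y z"
    and nonsingular: "\<And>x y d. x \<in> X \<Longrightarrow> y \<in> Y \<Longrightarrow> d \<in> charts_at AZ (zmax Z h g x y) \<Longrightarrow>
          invertible (D22 d h x (zmax Z h g x y) + D22 d g y (zmax Z h g x y))"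
    and h_twist: "twisted1 AX (closure X) (closure Z) h"
    and g_twist: "twisted2 AZ (closure Y) (closure Z) g"
    and A0: "Ck_prod AX AY 4 (closure X \<times> closure Y) b"
    and A1: "twisted1 AX (closure X) (closure Y) b"
    and A2: "\<And>x y c e. x \<in> X \<Longrightarrow> y \<in> Y \<Longrightarrow> c \<in> charts_at AX x \<Longrightarrow> e \<in> charts_at AY y \<Longrightarrow>
          invertible (D12 c e b x y)"
begin

abbreviation "zm \<equiv> zmax Z h g"

lemma b_C2: "Ck_prod AX AY 2 (closure X \<times> closure Y) b"
  using A0 by (rule Ck_prod_le) simp

lemma in_closure: "x \<in> X \<Longrightarrow> x \<in> closure X" "y \<in> Y \<Longrightarrow> y \<in> closure Y" "z \<in> Z \<Longrightarrow> z \<in> closure Z"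
  using closure_subset by blast+

section \<open>The maximizer: first-order conditions and continuity\<close>

lemma zmax_is_maximizer:
  assumes "x \<in> X" "y \<in> Y"
  shows "is_maximizer Z h g x y (zm x y)"
  unfolding zmax_def by (rule theI'[OF unique_max[OF assms]])

lemma zmax_mem: "x \<in> X \<Longrightarrow> y \<in> Y \<Longrightarrow> zm x y \<in> Z"
  using zmax_is_maximizer by (auto simp: is_maximizer_def)

lemma b_eq:
  assumes "x \<in> X" "y \<in> Y"
  shows "b x y = h x (zm x y) + g y (zm x y)"
proof -
  have "b x y = (SUP z\<in>Z. h x z + g y z)"
    using assms in_closure by (intro b_sup) auto
  also have "\<dots> = h x (zm x y) + g y (zm x y)"
    by (rule cSup_eq_maximum) (use zmax_is_maximizer[OF assms] in \<open>auto simp: is_maximizer_def\<close>)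
  finally show ?thesis .
qed

lemma b_ge: "x \<in> X \<Longrightarrow> y \<in> Y \<Longrightarrow> z \<in> Z \<Longrightarrow> h x z + g y z \<le> b x y"
  using zmax_is_maximizer[of x y] by (simp add: b_eq is_maximizer_def)

text \<open>Freeze \<open>z\<close> at the maximizer for \<open>(x, y)\<close>: the function b(., y)
  - h(., z) is at least g(y, z) near \<open>x\<close> and takes this value at \<open>x\<close>, an
  interior minimum. The argument uses no regularity of \<open>zm\<close>, so it can serve to prove
  the continuity of \<open>zm\<close>.\<close>

lemma envelope:
  assumes x: "x \<in> X" and y: "y \<in> Y" and c: "c \<in> charts_at AX x"
  shows "D1 c b x y = D1 c h x (zm x y)"
proof -
  note c' = smooth_atlas_chart[OF manifolds(1) c]
  define z where "z = zm x y"
  have z: "z \<in> Z" using zmax_mem[OF x y] by (simp add: z_def)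
  let ?S = "snd c ` (X \<inter> fst c)"
  let ?f = "\<lambda>\<xi>. b (chart_inv c \<xi>) y - h (chart_inv c \<xi>) z"
  have "(?f has_derivative (\<lambda>w. D1 c b x y \<bullet> w - D1 c h x z \<bullet> w)) (at (snd c x))"
    using x y z in_closure
    by (intro has_derivative_diff D1_has_derivative[OF manifolds(1,2) b_C2 _ c]
        D1_has_derivative[OF manifolds(1,3) h_C2 _ c]) auto
  moreover have "\<forall>\<xi>\<in>?S. ?f (snd c x) \<le> ?f \<xi>"
  proof
    fix \<xi> assume "\<xi> \<in> ?S"
    then have "chart_inv c \<xi> \<in> X" using c' by (auto simp: chart_inv_left)
    from b_ge[OF this y z] show "?f (snd c x) \<le> ?f \<xi>"
      using c' b_eq[OF x y] by (simp add: chart_inv_left z_def)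
  qed
  ultimately have "(\<lambda>w. D1 c b x y \<bullet> w - D1 c h x z \<bullet> w) = (\<lambda>w. 0)"
    using x c' opens(1) by (intro differential_zero_maxmin[of _ ?S]) (auto intro: open_chart_image)
  then have "D1 c b x y \<bullet> w = D1 c h x z \<bullet> w" for w
    by (meson eq_iff_diff_eq_0)
  then show ?thesis unfolding z_def using vector_eq_rdot by blast
qed

text \<open>\<open>Z\<close> is open, so the maximum over \<open>Z\<close> is an interior
  one.\<close>

lemma first_order_condition:
  assumes x: "x \<in> X" and y: "y \<in> Y" and a: "a \<in> charts_at AZ (zm x y)"
  shows "D2 a g y (zm x y) = - D2 a h x (zm x y)"
proof -
  define z where "z = zm x y"
  have z: "z \<in> Z" using zmax_mem[OF x y] by (simp add: z_def)
  have a: "a \<in> charts_at AZ z" using a by (simp add: z_def)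
  note a' = smooth_atlas_chart[OF manifolds(3) a]
  let ?S = "snd a ` (Z \<inter> fst a)"
  let ?f = "\<lambda>\<zeta>. h x (chart_inv a \<zeta>) + g y (chart_inv a \<zeta>)"
  have "(?f has_derivative (\<lambda>w. D2 a h x z \<bullet> w + D2 a g y z \<bullet> w)) (at (snd a z))"
    using x y z in_closure
    by (intro has_derivative_add D2_has_derivative[OF manifolds(1,3) h_C2 _ a]
        D2_has_derivative[OF manifolds(2,3) g_C2 _ a]) auto
  moreover have "\<forall>\<zeta>\<in>?S. ?f \<zeta> \<le> ?f (snd a z)"
  proof
    fix \<zeta> assume "\<zeta> \<in> ?S"
    then have "chart_inv a \<zeta> \<in> Z" using a' by (auto simp: chart_inv_left)
    then show "?f \<zeta> \<le> ?f (snd a z)"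
      using a' zmax_is_maximizer[OF x y] by (simp add: chart_inv_left z_def is_maximizer_def)
  qed
  ultimately have "(\<lambda>w. D2 a h x z \<bullet> w + D2 a g y z \<bullet> w) = (\<lambda>w. 0)"
    using z a' opens(3) by (intro differential_zero_maxmin[of _ ?S]) (auto intro: open_chart_image)
  then have "D2 a g y z \<bullet> w = - D2 a h x z \<bullet> w" for w
    by (metis add_eq_0_iff inner_minus_left)
  then show ?thesis unfolding z_def using vector_eq_rdot by blast
qed

text \<open>\<open>Z\<close> is not compact: a limit of maximizers could lie on its boundary or be a second maximizer over
  the closure. The envelope theorem and the twist of \<open>h\<close> on the closure exclude this.\<close>

lemma zmax_tendsto:
  assumes x: "x \<in> X" and y: "y \<in> Y" and \<xi>: "(\<xi> \<longlongrightarrow> x) F" and \<eta>: "(\<eta> \<longlongrightarrow> y) F"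
  shows "((\<lambda>t. zm (\<xi> t) (\<eta> t)) \<longlongrightarrow> zm x y) F"
proof (rule compact_tendsto_unique[OF compact_Z])
  have ev: "\<forall>\<^sub>F t in F. \<xi> t \<in> X" "\<forall>\<^sub>F t in F. \<eta> t \<in> Y"
    using topological_tendstoD[OF \<xi> opens(1) x] topological_tendstoD[OF \<eta> opens(2) y] .
  then show "\<forall>\<^sub>F t in F. zm (\<xi> t) (\<eta> t) \<in> closure Z"
    by eventually_elim (simp add: zmax_mem in_closure)
  obtain c where c: "c \<in> charts_at AX x" using smooth_atlas_ex_chart[OF manifolds(1)] by blast
  note c' = smooth_atlas_chart[OF manifolds(1) c]
  have evc: "\<forall>\<^sub>F t in F. \<xi> t \<in> fst c"
    using topological_tendstoD[OF \<xi>, of "fst c"] c' by (simp add: is_chart_def)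
  fix k assume k: "k \<in> closure Z" "k \<noteq> zm x y"
  let ?G = "F \<times>\<^sub>F nhds k"
  have "D1 c h x k \<noteq> D1 c h x (zm x y)"
  proof -
    have "inj_on (D1 c h x) (closure Z)"
      using h_twist c x in_closure by (simp add: twisted1_def)
    from inj_onD[OF this _ k(1)] show ?thesis
      using k(2) zmax_mem[OF x y] in_closure(3) by blast
  qed
  then have ne: "D1 c h x k - D1 c b x y \<noteq> 0"
    by (simp add: envelope[OF x y c])
  have fst: "filterlim fst F ?G" and snd: "filterlim snd (nhds k) ?G"
    by (rule filterlim_fst filterlim_snd)+
  \<comment> \<open>By \<open>envelope\<close> this difference is zero whenever \<open>snd p\<close>
    is the maximizer for \<open>\<xi> (fst p)\<close> and \<open>\<eta> (fst p)\<close>; its nonzero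
    limit excludes that near \<open>k\<close>.\<close>
  have "((\<lambda>p. D1 c h (\<xi> (fst p)) (snd p) - D1 c b (\<xi> (fst p)) (\<eta> (fst p))) \<longlongrightarrow> D1 c h x k - D1 c b x y) ?G"
    using x y k in_closure
    by (intro tendsto_diff tendsto_D1[OF manifolds(1,3) h_C2 _ c] tendsto_D1[OF manifolds(1,2) b_C2 _ c]
        filterlim_compose[OF \<xi> fst] filterlim_compose[OF \<eta> fst] snd) auto
  from tendsto_imp_eventually_ne[OF this ne]
  have "\<forall>\<^sub>F p in ?G. D1 c h (\<xi> (fst p)) (snd p) - D1 c b (\<xi> (fst p)) (\<eta> (fst p)) \<noteq> 0" .
  moreover have "\<forall>\<^sub>F p in ?G. \<xi> (fst p) \<in> X \<and> \<eta> (fst p) \<in> Y \<and> \<xi> (fst p) \<in> fst c"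
    using eventually_compose_filterlim[OF eventually_conj[OF ev(1) eventually_conj[OF ev(2) evc]] fst] .
  ultimately have "\<forall>\<^sub>F p in ?G. zm (\<xi> (fst p)) (\<eta> (fst p)) \<noteq> snd p"
  proof eventually_elim
    case (elim p)
    with envelope[of "\<xi> (fst p)" "\<eta> (fst p)" c] c show ?case
      by (auto simp: charts_at_def)
  qed
  then show "\<forall>\<^sub>F (t, k') in ?G. zm (\<xi> t) (\<eta> t) \<noteq> k'"
    by (simp add: case_prod_beta')
qed

text \<open>The right-hand side is the Schur complement of the z-block in the Hessian of (x, z) ->
  h(x, z) + g(y, z), as is usual for a function obtained by optimizing over z.\<close>

lemma hessian:
  assumes x: "x \<in> X" and y: "y \<in> Y" and z: "z = zm x y"
    and c: "c \<in> charts_at AX x" and d: "d \<in> charts_at AZ z"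
  shows "D11 c b x y = D11 c h x z
    - D12 c d h x z ** matrix_inv (D22 d h x z + D22 d g y z) ** transpose (D12 c d h x z)"
proof -
  obtain e where e: "e \<in> charts_at AY y" using smooth_atlas_ex_chart[OF manifolds(2)] by blast
  note c' = smooth_atlas_chart[OF manifolds(1) c] and d' = smooth_atlas_chart[OF manifolds(3) d]
    and e' = smooth_atlas_chart[OF manifolds(2) e]
  have zZ: "z \<in> Z" using zmax_mem[OF x y] by (simp add: z)
  obtain Vh where Vh: "Ck_rep 2 c d h Vh" "(snd c x, snd d z) \<in> Vh"
    using Ck_prod_Ck_rep[OF manifolds(1,3) h_C2 _ c d] x zZ in_closure by auto
  obtain Vg where Vg: "Ck_rep 2 e d g Vg" "(snd e y, snd d z) \<in> Vg"
    using Ck_prod_Ck_rep[OF manifolds(2,3) g_C2 _ e d] y zZ in_closure by auto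
  obtain Vb where Vb: "Ck_rep 2 c e b Vb" "(snd c x, snd e y) \<in> Vb"
    using Ck_prod_Ck_rep[OF manifolds(1,2) b_C2 _ c e] x y in_closure by auto
  have op: "open Vh" "open Vg" "open Vb" using Vh Vg Vb by (auto simp: Ck_rep_def)
  define \<xi>0 \<zeta>0 \<eta>0 where "\<xi>0 = snd c x" and "\<zeta>0 = snd d z" and "\<eta>0 = snd e y"
  have inv: "chart_inv c \<xi>0 = x" "chart_inv d \<zeta>0 = z" "chart_inv e \<eta>0 = y"
    using c' d' e' by (simp_all add: \<xi>0_def \<zeta>0_def \<eta>0_def chart_inv_left)
  have mem: "(\<xi>0, \<zeta>0) \<in> Vh" "(\<eta>0, \<zeta>0) \<in> Vg" "(\<xi>0, \<eta>0) \<in> Vb"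
    using Vh Vg Vb by (simp_all add: \<xi>0_def \<zeta>0_def \<eta>0_def)
  define H G B where "H = chart_rep c d h" and "G = chart_rep e d g" and "B = chart_rep c e b"
  define L M where "L = D12 c d h x z" and "M = D22 d h x z + D22 d g y z"
  have M: "invertible M" unfolding M_def z by (rule nonsingular) (use x y d z in auto)
  define zf where "zf = (\<lambda>\<xi>. snd d (zm (chart_inv c \<xi>) y))"
  have zf0: "zf \<xi>0 = \<zeta>0" by (simp add: zf_def inv(1) \<zeta>0_def z)
  have cinv: "(chart_inv c \<longlongrightarrow> x) (nhds \<xi>0)"
    using isCont_chart_inv[of c \<xi>0] c' inv by (auto simp: isCont_def tendsto_at_iff_tendsto_nhds \<xi>0_def)
  have zlim: "((\<lambda>\<xi>. zm (chart_inv c \<xi>) y) \<longlongrightarrow> z) (nhds \<xi>0)"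
    unfolding z by (rule zmax_tendsto[OF x y cinv tendsto_const])
  have zflim: "(zf \<longlongrightarrow> \<zeta>0) (nhds \<xi>0)"
    unfolding zf_def \<zeta>0_def using isCont_chart[of d z] d' zlim by (auto intro: isCont_tendsto_compose)
  have pairlim: "((\<lambda>\<xi>. (\<xi>, zf \<xi>)) \<longlongrightarrow> (\<xi>0, \<zeta>0)) (nhds \<xi>0)"
    "((\<lambda>\<xi>. (\<eta>0, zf \<xi>)) \<longlongrightarrow> (\<eta>0, \<zeta>0)) (nhds \<xi>0)"
    "((\<lambda>\<xi>. (\<xi>, \<eta>0)) \<longlongrightarrow> (\<xi>0, \<eta>0)) (nhds \<xi>0)"
    using zflim by (auto intro!: tendsto_Pair simp: filterlim_ident)
  \<comment> \<open>The charts \<open>c\<close> and \<open>d\<close>, chosen at \<open>x\<close> and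
    \<open>z\<close>, remain valid near \<open>\<xi>0\<close>; for \<open>d\<close> this rests on
    the continuity of the maximizer.\<close>
  have ev: "\<forall>\<^sub>F \<xi> in nhds \<xi>0. chart_inv c \<xi> \<in> X \<and> c \<in> charts_at AX (chart_inv c \<xi>) \<and>
      d \<in> charts_at AZ (zm (chart_inv c \<xi>) y) \<and> chart_inv d (zf \<xi>) = zm (chart_inv c \<xi>) y \<and>
      (\<xi>, zf \<xi>) \<in> Vh \<and> (\<eta>0, zf \<xi>) \<in> Vg \<and> (\<xi>, \<eta>0) \<in> Vb"
  proof -
    have "open (fst c)" "open (fst d)" "x \<in> fst c" "z \<in> fst d"
      using c' d' by (auto simp: is_chart_def)
    from topological_tendstoD[OF cinv this(1,3)] topological_tendstoD[OF zlim this(2,4)]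
      topological_tendstoD[OF cinv opens(1) x] topological_tendstoD[OF pairlim(1) op(1) mem(1)]
      topological_tendstoD[OF pairlim(2) op(2) mem(2)] topological_tendstoD[OF pairlim(3) op(3) mem(3)]
    show ?thesis
    proof eventually_elim
      case (elim \<xi>)
      then show ?case using c c' d d' by (simp add: charts_at_def zf_def chart_inv_left)
    qed
  qed
  \<comment> \<open>The z-derivative of h + g with \<open>y\<close> fixed; near
    \<open>\<xi>0\<close> it vanishes along the graph of \<open>zf\<close>, which makes
    \<open>zf\<close> an implicit function.\<close>
  define P where "P = (\<lambda>(\<xi>, \<zeta>). D2 d h (chart_inv c \<xi>) (chart_inv d \<zeta>) + D2 d g y (chart_inv d \<zeta>))"
  have PD: "(P has_derivative (\<lambda>(a, k). transpose L *v a + M *v k)) (at (\<xi>0, zf \<xi>0))"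
  proof (rule has_derivative_inner_all)
    fix u
    let ?V = "Vh \<inter> {p. (\<eta>0, snd p) \<in> Vg}"
    have "open ?V"
    proof (rule open_Int[OF op(1)])
      have "continuous_on UNIV (\<lambda>p :: (real ^ 'n) \<times> (real ^ 'n). (\<eta>0, snd p))"
        by (intro continuous_on_Pair continuous_on_const continuous_on_snd continuous_on_id)
      from open_vimage[OF op(2) this] show "open {p :: (real ^ 'n) \<times> (real ^ 'n). (\<eta>0, snd p) \<in> Vg}" by (simp add: vimage_def)
    qed
    note dH = has_derivative_dirderiv[OF Ck_rep_differentiable2[OF Vh(1) mem(1)], folded H_def]
    note dG = has_derivative_dirderiv[OF Ck_rep_differentiable2[OF Vg(1) mem(2)], folded G_def]
    have sndD: "((\<lambda>p. (\<eta>0, snd p)) has_derivative (\<lambda>p. (0, snd p))) (at (\<xi>0, \<zeta>0))"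
      by (intro has_derivative_Pair has_derivative_const has_derivative_snd has_derivative_ident)
    have dG': "((\<lambda>p. dirderiv (0, u) G (\<eta>0, snd p)) has_derivative
        (\<lambda>p. dirderiv (0, snd p) (dirderiv (0, u) G) (\<eta>0, \<zeta>0))) (at (\<xi>0, \<zeta>0))"
      using has_derivative_compose[OF sndD, of "dirderiv (0, u) G"
          "\<lambda>w. dirderiv w (dirderiv (0, u) G) (\<eta>0, \<zeta>0)"] dG[of "(0, u)"] by simp
    have "((\<lambda>p. dirderiv (0, u) H p + dirderiv (0, u) G (\<eta>0, snd p)) has_derivative
        (\<lambda>p. dirderiv p (dirderiv (0, u) H) (\<xi>0, \<zeta>0) + dirderiv (0, snd p) (dirderiv (0, u) G) (\<eta>0, \<zeta>0)))
        (at (\<xi>0, \<zeta>0))"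
      by (rule has_derivative_add[OF dH dG'])
    moreover have "dirderiv p (dirderiv (0, u) H) (\<xi>0, \<zeta>0) + dirderiv (0, snd p) (dirderiv (0, u) G) (\<eta>0, \<zeta>0)
        = (case p of (a, k) \<Rightarrow> transpose L *v a + M *v k) \<bullet> u" for p
    proof (cases p)
      case (Pair a k)
      have "dirderiv p (dirderiv (0, u) H) (\<xi>0, \<zeta>0)
          = dirderiv (a, 0) (dirderiv (0, u) H) (\<xi>0, \<zeta>0) + dirderiv (0, k) (dirderiv (0, u) H) (\<xi>0, \<zeta>0)"
        using linear_add[OF has_derivative_linear[OF dH], of "(a, 0)" "(0, k)"] by (simp add: Pair)
      \<comment> \<open>\<open>L\<close> differentiates D_x h in z, whereas \<open>P\<close> has D_z
        h differentiated in x; symmetry identifies this block with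
        \<open>transpose L\<close>.\<close>
      moreover have "dirderiv (a, 0) (dirderiv (0, u) H) (\<xi>0, \<zeta>0) = dirderiv (0, u) (dirderiv (a, 0) H) (\<xi>0, \<zeta>0)"
        unfolding H_def using Vh(1) by (intro dirderiv_commute[OF op(1) _ mem(1)]) (simp add: Ck_rep_def)
      moreover have "\<dots> = a \<bullet> (L *v u)"
        using D12_rep(1)[OF Vh(1) mem(1), of a u] by (simp add: inv L_def H_def)
      moreover have "dirderiv (0, k) (dirderiv (0, u) H) (\<xi>0, \<zeta>0) = u \<bullet> (D22 d h x z *v k)"
        using D22_rep[OF Vh(1) mem(1), of u k] by (simp add: inv H_def)
      moreover have "dirderiv (0, k) (dirderiv (0, u) G) (\<eta>0, \<zeta>0) = u \<bullet> (D22 d g y z *v k)"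
        using D22_rep[OF Vg(1) mem(2), of u k] by (simp add: inv G_def)
      moreover have "a \<bullet> (L *v u) = (transpose L *v a) \<bullet> u"
        by (simp add: dot_lmul_matrix)
      ultimately show ?thesis
        by (simp add: Pair M_def matrix_vector_mult_add_rdistrib inner_add_left inner_add_right inner_commute del: transpose_matrix_vector)
    qed
    ultimately have "((\<lambda>p. dirderiv (0, u) H p + dirderiv (0, u) G (\<eta>0, snd p)) has_derivative
        (\<lambda>p. (case p of (a, k) \<Rightarrow> transpose L *v a + M *v k) \<bullet> u)) (at (\<xi>0, \<zeta>0))"
      by (simp only:)
    then show "((\<lambda>p. P p \<bullet> u) has_derivative
        (\<lambda>p. (case p of (a, k) \<Rightarrow> transpose L *v a + M *v k) \<bullet> u)) (at (\<xi>0, zf \<xi>0))"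
      unfolding zf0
    proof (rule has_derivative_transform_within_open[OF _ \<open>open ?V\<close>])
      show "(\<xi>0, \<zeta>0) \<in> ?V" using mem by simp
      fix p assume "p \<in> ?V"
      then show "dirderiv (0, u) H p + dirderiv (0, u) G (\<eta>0, snd p) = P p \<bullet> u"
        using D2_rep[OF Vh(1), of "fst p" "snd p" u] D2_rep[OF Vg(1), of \<eta>0 "snd p" u]
        by (simp add: P_def case_prod_beta inner_add_left H_def G_def inv)
    qed
  qed
  have zero: "\<forall>\<^sub>F \<xi> in nhds \<xi>0. P (\<xi>, zf \<xi>) = 0"
    using ev
  proof eventually_elim
    case (elim \<xi>)
    then show ?case
      using first_order_condition[of "chart_inv c \<xi>" y d] y by (simp add: P_def)
  qed
  have zfD: "(zf has_derivative (\<lambda>a. - (matrix_inv M *v (transpose L *v a)))) (at \<xi>0)"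
  proof (rule implicit_has_derivative[OF PD _ _ _ _ zero])
    show "bounded_linear ((*v) (transpose L))" "bounded_linear ((*v) (matrix_inv M))"
      by (simp_all add: matrix_vector_mul_bounded_linear del: transpose_matrix_vector)
    show "matrix_inv M *v (M *v k) = k" for k
      by (simp add: matrix_vector_mul_assoc matrix_inv_invertible[OF M])
    show "isCont zf \<xi>0" using zflim tendsto_at_iff_tendsto_nhds[of zf \<xi>0] by (simp add: isCont_def zf0)
  qed
  have "u \<bullet> (D11 c b x y *v w) = u \<bullet> ((D11 c h x z - L ** matrix_inv M ** transpose L) *v w)" for u w
  proof -
    note dH = has_derivative_dirderiv[OF Ck_rep_differentiable2[OF Vh(1) mem(1)], folded H_def]
    have "((\<lambda>\<xi>. (\<xi>, zf \<xi>)) has_derivative (\<lambda>a. (a, - (matrix_inv M *v (transpose L *v a))))) (at \<xi>0)"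
      using zfD by (intro has_derivative_Pair has_derivative_ident)
    from has_derivative_compose[OF this, of "dirderiv (u, 0) H"
        "\<lambda>w. dirderiv w (dirderiv (u, 0) H) (\<xi>0, \<zeta>0)"] dH[of "(u, 0)"]
    have D1: "((\<lambda>\<xi>. dirderiv (u, 0) H (\<xi>, zf \<xi>)) has_derivative
        (\<lambda>a. dirderiv (a, - (matrix_inv M *v (transpose L *v a))) (dirderiv (u, 0) H) (\<xi>0, \<zeta>0))) (at \<xi>0)"
      by (simp add: zf0)
    have D2: "((\<lambda>\<xi>. dirderiv (u, 0) B (\<xi>, \<eta>0)) has_derivative
        (\<lambda>a. dirderiv (a, 0) (dirderiv (u, 0) B) (\<xi>0, \<eta>0))) (at \<xi>0)"
      unfolding B_def by (rule has_derivative_partial1[OF Ck_rep_differentiable2[OF Vb(1) mem(3)]])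
    have ev': "\<forall>\<^sub>F \<xi> in nhds \<xi>0. dirderiv (u, 0) B (\<xi>, \<eta>0) = dirderiv (u, 0) H (\<xi>, zf \<xi>)"
      using ev
    proof eventually_elim
      case (elim \<xi>)
      then show ?case
        using D1_rep[OF Vb(1), of \<xi> \<eta>0 u] D1_rep[OF Vh(1), of \<xi> "zf \<xi>" u]
          envelope[of "chart_inv c \<xi>" y c] y by (simp add: B_def H_def inv)
    qed
    \<comment> \<open>Both sides of the envelope identity are the same germ at
      \<open>\<xi>0\<close>, so their derivatives agree.\<close>
    have "(\<lambda>a. dirderiv (a, 0) (dirderiv (u, 0) B) (\<xi>0, \<eta>0))
        = (\<lambda>a. dirderiv (a, - (matrix_inv M *v (transpose L *v a))) (dirderiv (u, 0) H) (\<xi>0, \<zeta>0))"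
      by (rule has_derivative_unique[OF has_derivative_cong_nhds[OF D2 ev'] D1])
    then have "dirderiv (w, 0) (dirderiv (u, 0) B) (\<xi>0, \<eta>0)
        = dirderiv (w, - (matrix_inv M *v (transpose L *v w))) (dirderiv (u, 0) H) (\<xi>0, \<zeta>0)"
      by (rule fun_cong)
    also have "\<dots> = dirderiv (w, 0) (dirderiv (u, 0) H) (\<xi>0, \<zeta>0)
        + dirderiv (0, - (matrix_inv M *v (transpose L *v w))) (dirderiv (u, 0) H) (\<xi>0, \<zeta>0)"
      using linear_add[OF has_derivative_linear[OF dH], of "(w, 0)" "(0, - (matrix_inv M *v (transpose L *v w)))" "(u, 0)"]
      by simp
    also have "\<dots> = u \<bullet> (D11 c h x z *v w) + u \<bullet> (L *v (- (matrix_inv M *v (transpose L *v w))))"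
      using D11_rep[OF Vh(1) mem(1), of u w] D12_rep(1)[OF Vh(1) mem(1), of u]
      by (simp add: inv L_def H_def del: transpose_matrix_vector)
    also have "\<dots> = u \<bullet> ((D11 c h x z - L ** matrix_inv M ** transpose L) *v w)"
      by (simp add: matrix_vector_mult_diff_rdistrib inner_diff_right matrix_vector_mul_assoc
          linear_neg[OF matrix_vector_mul_linear] matrix_mul_assoc del: transpose_matrix_vector)
    finally show ?thesis
      using D11_rep[OF Vb(1) mem(3), of u w] by (simp add: inv B_def)
  qed
  then have "D11 c b x y *v w = (D11 c h x z - L ** matrix_inv M ** transpose L) *v w" for w
    using vector_eq_ldot by blast
  then show ?thesis unfolding L_def M_def by (metis matrix_eq)
qed

section \<open>The curve b-exp(tp + q) and the curvature along it\<close>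

lemma bexp_curve:
  assumes x: "x \<in> X" and y: "y \<in> Y" and c: "c \<in> charts_at AX x" and e: "e \<in> charts_at AY y"
    and q: "D1 c b x y = q"
  obtains y' a where
    "\<forall>\<^sub>F t in nhds 0. bexp c Y b x (t *\<^sub>R p + q) \<in> Y \<inter> fst e \<and> D1 c b x (bexp c Y b x (t *\<^sub>R p + q)) = t *\<^sub>R p + q"
    "\<forall>\<^sub>F t in nhds 0. ((\<lambda>t. snd e (bexp c Y b x (t *\<^sub>R p + q))) has_vector_derivative y' t) (at t)"
    "D12 c e b x y *v y' 0 = p" "(y' has_vector_derivative a) (at 0)" "bexp c Y b x q = y"
proof -
  note c' = smooth_atlas_chart[OF manifolds(1) c] and e' = smooth_atlas_chart[OF manifolds(2) e]
  obtain V where V: "Ck_rep 4 c e b V" "(snd c x, snd e y) \<in> V"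
    using Ck_prod_Ck_rep[OF manifolds(1,2) A0 _ c e] x y in_closure by auto
  have V2: "Ck_rep 2 c e b V" using V(1) by (rule Ck_rep_le) simp
  define B where "B = chart_rep c e b"
  have B4: "Ck_on (Suc (Suc (Suc (Suc 0)))) V B" and V_open: "open V"
    using V(1) by (simp_all add: Ck_rep_def B_def numeral_eq_Suc)
  define S where "S = snd e ` (Y \<inter> fst e) \<inter> {\<eta>. (snd c x, \<eta>) \<in> V}"
  \<comment> \<open>D_x b(x, .) in the chart \<open>e\<close>: injective on \<open>S\<close> by
    \<open>A1\<close>, with derivative \<open>D12\<close>, which \<open>A2\<close> makes invertible.
    Its inverse on the image of \<open>S\<close> is \<open>bexp\<close> read in
    \<open>e\<close>.\<close>
  define f where "f = (\<lambda>\<eta>. D1 c b x (chart_inv e \<eta>))"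
  have bexp: "bexp c Y b x (D1 c b x y) = y" if "y \<in> Y" for y
  proof -
    have "inj_on (\<lambda>y. D1 c b x y) (closure Y)"
      using A1 x c in_closure by (simp add: twisted1_def)
    then show ?thesis unfolding bexp_def by (rule inv_into_f_f) (use that in_closure in auto)
  qed
  have S: "open S" unfolding S_def
    using open_slice2[OF V_open] open_chart_image[of e Y] e' opens(2) by (intro open_Int) auto
  have inS: "chart_inv e \<eta> \<in> Y \<inter> fst e" "snd e (chart_inv e \<eta>) = \<eta>" "(snd c x, \<eta>) \<in> V" if "\<eta> \<in> S" for \<eta>
    using that e' by (auto simp: S_def chart_inv_left)
  have yS: "snd e y \<in> S" "f (snd e y) = q"
    using y e' V(2) q by (auto simp: S_def f_def chart_inv_left)
  have cx: "chart_inv c (snd c x) = x" using c' by (simp add: chart_inv_left)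
  define g where "g = (\<lambda>r. snd e (bexp c Y b x r))"
  have gf: "g (f \<eta>) = \<eta>" if "\<eta> \<in> S" for \<eta>
    using inS[OF that] bexp by (simp add: g_def f_def)
  have "inj_on f S" using gf by (metis inj_onI)
  have fd: "f differentiable (at \<eta>)" if "\<eta> \<in> S" for \<eta>
    using D12_rep(2)[OF V2 inS(3)[OF that]] by (simp add: cx f_def)
  have fB: "dirderiv w f \<eta> \<bullet> u = dirderiv (0, w) (dirderiv (u, 0) B) (snd c x, \<eta>)"
    "dirderiv w f \<eta> = D12 c e b x (chart_inv e \<eta>) *v w" if "\<eta> \<in> S" for w u \<eta>
  proof -
    have "(f has_derivative (*v) (jacobian f (at \<eta>))) (at \<eta>)"
      using fd[OF that] by (simp add: jacobian_works)
    moreover have "jacobian f (at \<eta>) = D12 c e b x (chart_inv e \<eta>)"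
      by (simp add: D12_def f_def inS[OF that])
    ultimately show *: "dirderiv w f \<eta> = D12 c e b x (chart_inv e \<eta>) *v w"
      by (simp add: dirderiv_eq)
    show "dirderiv w f \<eta> \<bullet> u = dirderiv (0, w) (dirderiv (u, 0) B) (snd c x, \<eta>)"
      using D12_rep(1)[OF V2 inS(3)[OF that], of u w] by (simp add: * cx B_def inner_commute)
  qed
  have fd2: "dirderiv w f differentiable (at \<eta>)" if \<eta>: "\<eta> \<in> S" for w \<eta>
    unfolding differentiable_componentwise_within[of "dirderiv w f"]
  proof
    fix u :: "real ^ 'n"
    \<comment> \<open>The components of the derivative of \<open>f\<close> are second derivatives of
      the C^4 function \<open>B\<close>, hence still differentiable.\<close>
    have "dirderiv (0, w) (dirderiv (u, 0) B) differentiable (at (snd c x, \<eta>))"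
      using Ck_on_differentiable[OF Ck_on_dirderiv[OF Ck_on_dirderiv[OF B4]] _ inS(3)[OF \<eta>]] by simp
    from has_derivative_transform_within_open[OF has_derivative_partial2[OF this] S \<eta> fB(1)[symmetric]]
    show "(\<lambda>\<eta>. dirderiv w f \<eta> \<bullet> u) differentiable (at \<eta>)"
      by (rule differentiableI)
  qed
  define N where "N \<eta> = (*v) (matrix_inv (D12 c e b x (chart_inv e \<eta>)))" for \<eta>
  have inv: "invertible (D12 c e b x (chart_inv e \<eta>))" if "\<eta> \<in> S" for \<eta>
    using inS(1)[OF that] e by (intro A2[OF x _ c]) (auto simp: charts_at_def)
  obtain y' a where *: "\<forall>\<^sub>F t in nhds 0. t *\<^sub>R p + q \<in> f ` S"
    "\<forall>\<^sub>F t in nhds 0. ((\<lambda>t. g (t *\<^sub>R p + q)) has_vector_derivative y' t) (at t)"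
    "y' 0 = N (snd e y) p" "(y' has_vector_derivative a) (at 0)"
  proof (rule inverse_curve_twice_differentiable[OF S \<open>inj_on f S\<close> yS fd fd2, of N g p])
    show "linear (N \<eta>)" for \<eta> by (simp add: N_def)
    show "dirderiv (N \<eta> w) f \<eta> = w" "N \<eta> (dirderiv w f \<eta>) = w" if "\<eta> \<in> S" for \<eta> w
      using matrix_inv_invertible[OF inv[OF that]]
      by (simp_all add: fB(2)[OF that] N_def matrix_vector_mul_assoc)
  qed (use gf in auto)
  show ?thesis
  proof (rule that)
    show "\<forall>\<^sub>F t in nhds 0. bexp c Y b x (t *\<^sub>R p + q) \<in> Y \<inter> fst e
        \<and> D1 c b x (bexp c Y b x (t *\<^sub>R p + q)) = t *\<^sub>R p + q"
      using *(1)
    proof eventually_elim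
      case (elim t)
      then obtain \<eta> where "\<eta> \<in> S" "t *\<^sub>R p + q = D1 c b x (chart_inv e \<eta>)" by (auto simp: f_def)
      then show ?case using inS(1)[of \<eta>] bexp[of "chart_inv e \<eta>"] by simp
    qed
    show "\<forall>\<^sub>F t in nhds 0. ((\<lambda>t. snd e (bexp c Y b x (t *\<^sub>R p + q))) has_vector_derivative y' t) (at t)"
      using *(2) by (simp add: g_def)
    show "D12 c e b x y *v y' 0 = p"
      using matrix_inv_invertible[OF A2[OF x y c e]] e'
      by (simp add: *(3) N_def matrix_vector_mul_assoc chart_inv_left)
    show "bexp c Y b x q = y" using bexp[OF y] q by simp
  qed (rule *(4))
qed

text \<open>\<open>u\<close> is produced as the initial velocity of the curve. As
  \<open>D12 c e b x y *v u = p\<close>, the curve inside \<open>has_MTW\<close> for this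
  \<open>u\<close> is the given one.\<close>

lemma MTW_eq:
  assumes x: "x \<in> X" and y: "y \<in> Y" and c: "c \<in> charts_at AX x" and e: "e \<in> charts_at AY y"
    and q: "D1 c b x y = q"
  obtains u m where
    "((\<lambda>t. snd e (bexp c Y b x (t *\<^sub>R p + q))) has_vector_derivative u) (at 0)"
    "has_MTW AX X Y b c e x y v u m"
    "has_second_derivative (\<lambda>t. v \<bullet> (D11 c b x (bexp c Y b x (t *\<^sub>R p + q)) *v v)) m 0"
proof -
  note c' = smooth_atlas_chart[OF manifolds(1) c] and e' = smooth_atlas_chart[OF manifolds(2) e]
  obtain V where V: "Ck_rep 4 c e b V" "(snd c x, snd e y) \<in> V"
    using Ck_prod_Ck_rep[OF manifolds(1,2) A0 _ c e] x y in_closure by auto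
  have V2: "Ck_rep 2 c e b V" using V(1) by (rule Ck_rep_le) simp
  define B where "B = chart_rep c e b"
  have B4: "Ck_on (Suc (Suc (Suc (Suc 0)))) V B" and V_open: "open V"
    using V(1) by (simp_all add: Ck_rep_def B_def numeral_eq_Suc)
  have B2: "Ck_on 2 V B" using V2 by (simp add: Ck_rep_def B_def)
  have dB2: "Ck_on 2 V (dirderiv w B)" "Ck_on 2 V (dirderiv w' (dirderiv w B))" for w w'
    using Ck_on_le[OF Ck_on_dirderiv[OF B4, of w], of 2] Ck_on_dirderiv[OF Ck_on_dirderiv[OF B4, of w], of w']
    by (simp_all add: numeral_2_eq_2 del: Ck_on.simps)
  define \<xi>0 \<eta>0 where "\<xi>0 = snd c x" and "\<eta>0 = snd e y"
  have inv: "chart_inv c \<xi>0 = x" "chart_inv e \<eta>0 = y"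
    using c' e' by (simp_all add: \<xi>0_def \<eta>0_def chart_inv_left)
  have mem: "(\<xi>0, \<eta>0) \<in> V" using V by (simp add: \<xi>0_def \<eta>0_def)
  define yb where "yb = (\<lambda>t. bexp c Y b x (t *\<^sub>R p + q))"
  obtain y' a where yb: "\<forall>\<^sub>F t in nhds 0. yb t \<in> Y \<inter> fst e \<and> D1 c b x (yb t) = t *\<^sub>R p + q"
    and y': "\<forall>\<^sub>F t in nhds 0. ((\<lambda>t. snd e (yb t)) has_vector_derivative y' t) (at t)"
    and u: "D12 c e b x y *v y' 0 = p" and a: "(y' has_vector_derivative a) (at 0)"
    and yb0: "yb 0 = y"
    using bexp_curve[OF x y c e q, of p] unfolding yb_def by auto
  define u where "u = y' 0"
  define \<eta> where "\<eta> = (\<lambda>t. snd e (yb t))"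
  have \<eta>0: "\<eta> 0 = \<eta>0" by (simp add: \<eta>_def yb0 \<eta>0_def)
  have \<eta>': "(\<eta> has_vector_derivative u) (at 0)"
    using eventually_nhds_x_imp_x[OF y'] by (simp add: \<eta>_def u_def)
  have \<eta>lim: "(\<eta> \<longlongrightarrow> \<eta>0) (nhds 0)"
    using has_derivative_continuous[OF \<eta>'[unfolded has_vector_derivative_def]]
      tendsto_at_iff_tendsto_nhds[of \<eta> 0] by (simp add: isCont_def \<eta>0)
  \<comment> \<open>\<open>a\<close> is the acceleration of the curve in the chart \<open>e\<close>:
    the curve is straight as a covector D_x b(x, y_t), but in general not in coordinates of
    \<open>Y\<close>.\<close>
  have along: "has_second_derivative (\<lambda>t. F (\<xi>, \<eta> t))
      (dirderiv (0, u) (dirderiv (0, u) F) (\<xi>, \<eta>0) + dirderiv (0, a) F (\<xi>, \<eta>0)) 0"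
    if F: "Ck_on 2 V F" and \<xi>: "(\<xi>, \<eta>0) \<in> V" for F :: "(real ^ 'n) \<times> (real ^ 'n) \<Rightarrow> real" and \<xi>
  proof -
    have "\<forall>\<^sub>F t in nhds 0. ((\<lambda>t. (\<xi>, \<eta> t)) has_vector_derivative (0, y' t)) (at t)"
      using y' by eventually_elim (auto simp: \<eta>_def intro!: has_vector_derivative_Pair)
    moreover have "((\<lambda>t. (0, y' t)) has_vector_derivative (0, a)) (at 0)"
      using a by (intro has_vector_derivative_Pair) auto
    ultimately show ?thesis
      using has_second_derivative_chain[OF V_open F, of "\<lambda>t. (\<xi>, \<eta> t)" 0 "\<lambda>t. (0, y' t)" "(0, a)"] \<xi>
      by (simp add: \<eta>0 u_def)
  qed
  have evV: "\<forall>\<^sub>F t in nhds 0. (\<xi>0, \<eta> t) \<in> V"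
    using topological_tendstoD[OF tendsto_Pair[OF tendsto_const \<eta>lim] V_open mem] .
  define m where "m = dirderiv (0, u) (dirderiv (0, u) (dirderiv (v, 0) (dirderiv (v, 0) B))) (\<xi>0, \<eta>0)
    + dirderiv (0, a) (dirderiv (v, 0) (dirderiv (v, 0) B)) (\<xi>0, \<eta>0)"
  have "has_second_derivative (\<lambda>t. v \<bullet> (D11 c b x (yb t) *v v)) m 0"
    unfolding m_def
  proof (rule has_second_derivative_cong[OF along[OF dB2(2) mem]])
    show "\<forall>\<^sub>F t in nhds 0. dirderiv (v, 0) (dirderiv (v, 0) B) (\<xi>0, \<eta> t) = v \<bullet> (D11 c b x (yb t) *v v)"
      using evV yb
    proof eventually_elim
      case (elim t)
      then show ?case
        using D11_rep[OF V2, of \<xi>0 "\<eta> t" v v] e' by (simp add: inv B_def \<eta>_def chart_inv_left)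
    qed
  qed
  moreover have "has_MTW AX X Y b c e x y v u m"
    unfolding has_MTW_def Let_def
  proof (intro allI impI)
    fix \<beta> assume \<beta>: "smooth_curve_through AX X c x v \<beta>"
    obtain \<gamma>' \<alpha> where ev\<beta>: "\<forall>\<^sub>F s in nhds 0. \<beta> s \<in> X \<and> \<beta> s \<in> fst c"
      and \<gamma>': "\<forall>\<^sub>F s in nhds 0. ((\<lambda>s. snd c (\<beta> s)) has_vector_derivative \<gamma>' s) (at s)"
        "\<gamma>' 0 = v" "(\<gamma>' has_vector_derivative \<alpha>) (at 0)"
      using smooth_curveE[OF \<beta> c] c' by blast
    define \<gamma> where "\<gamma> = (\<lambda>s. snd c (\<beta> s))"
    have \<gamma>0: "\<gamma> 0 = \<xi>0" using \<beta> by (auto simp: smooth_curve_through_def \<gamma>_def \<xi>0_def)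
    have \<gamma>lim: "(\<gamma> \<longlongrightarrow> \<xi>0) (nhds 0)"
      using has_derivative_continuous[OF eventually_nhds_x_imp_x[OF \<gamma>'(1), unfolded has_vector_derivative_def]]
        tendsto_at_iff_tendsto_nhds[of \<gamma> 0] by (simp add: isCont_def \<gamma>0 flip: \<gamma>_def)
    have evV\<gamma>: "\<forall>\<^sub>F s in nhds 0. (\<gamma> s, \<eta>0) \<in> V"
      using topological_tendstoD[OF tendsto_Pair[OF \<gamma>lim tendsto_const] V_open mem] .
    define U A where "U = dirderiv (0, u) (dirderiv (0, u) B)" and "A = dirderiv (0, a) B"
    \<comment> \<open>The second t-derivative at position \<open>\<beta> s\<close>. The curve in
      \<open>Y\<close> stays based at \<open>x\<close>, so \<open>s\<close> enters only through
      \<open>\<gamma> s\<close>.\<close>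
    define w where "w = (\<lambda>s. U (\<gamma> s, \<eta>0) + A (\<gamma> s, \<eta>0))"
    have along\<gamma>: "has_second_derivative (\<lambda>s. F (\<gamma> s, \<eta>0))
        (dirderiv (v, 0) (dirderiv (v, 0) F) (\<xi>0, \<eta>0) + dirderiv (\<alpha>, 0) F (\<xi>0, \<eta>0)) 0"
      if F: "Ck_on 2 V F" for F :: "(real ^ 'n) \<times> (real ^ 'n) \<Rightarrow> real"
    proof -
      have "\<forall>\<^sub>F s in nhds 0. ((\<lambda>s. (\<gamma> s, \<eta>0)) has_vector_derivative (\<gamma>' s, 0)) (at s)"
        using \<gamma>'(1) by eventually_elim (auto simp: \<gamma>_def intro!: has_vector_derivative_Pair)
      moreover have "((\<lambda>s. (\<gamma>' s, 0)) has_vector_derivative (\<alpha>, 0)) (at 0)"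
        using \<gamma>'(3) by (intro has_vector_derivative_Pair) auto
      ultimately show ?thesis
        using has_second_derivative_chain[OF V_open F, of "\<lambda>s. (\<gamma> s, \<eta>0)" 0 "\<lambda>s. (\<gamma>' s, 0)" "(\<alpha>, 0)"] mem
        by (simp add: \<gamma>0 \<gamma>'(2))
    qed
    have "\<forall>\<^sub>F s in nhds 0. has_second_derivative (\<lambda>t. b (\<beta> s) (yb t)) (w s) 0"
      using ev\<beta> evV\<gamma>
    proof eventually_elim
      case (elim s)
      have "\<forall>\<^sub>F t in nhds 0. B (\<gamma> s, \<eta> t) = b (\<beta> s) (yb t)"
        using yb by eventually_elim (use elim c' e' in \<open>simp add: B_def chart_rep_def \<gamma>_def \<eta>_def chart_inv_left\<close>)
      from has_second_derivative_cong[OF along[OF B2 elim(2)] this]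
      show ?case by (simp add: w_def U_def A_def)
    qed
    moreover have "has_second_derivative w m 0"
    proof -
      have "has_second_derivative (\<lambda>t. dirderiv (\<alpha>, 0) B (\<xi>0, \<eta> t)) 0 0"
      proof (rule has_second_derivative_cong)
        have "((\<lambda>t. \<alpha> \<bullet> (t *\<^sub>R p + q)) has_real_derivative \<alpha> \<bullet> p) (at t)" for t
          by (auto simp: inner_add_right intro!: derivative_eq_intros)
        then show "has_second_derivative (\<lambda>t. \<alpha> \<bullet> (t *\<^sub>R p + q)) 0 0"
          unfolding has_second_derivative_def by (intro exI[of _ "\<lambda>_. \<alpha> \<bullet> p"]) auto
        show "\<forall>\<^sub>F t in nhds 0. \<alpha> \<bullet> (t *\<^sub>R p + q) = dirderiv (\<alpha>, 0) B (\<xi>0, \<eta> t)"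
          using evV yb
        proof eventually_elim
          case (elim t)
          then show ?case
            using D1_rep[OF V2, of \<xi>0 "\<eta> t" \<alpha>] e'
            by (simp add: inv B_def \<eta>_def chart_inv_left inner_commute)
        qed
      qed
      \<comment> \<open>One second derivative computed by the chain rule and from the affine form.
        Their equality cancels the two terms of \<open>wD\<close> containing the acceleration
        \<open>\<alpha>\<close>, so the value depends on the curve only through
        \<open>v\<close>.\<close>
      from has_second_derivative_unique[OF along[OF dB2(1) mem] this]
      have zero: "dirderiv (0, u) (dirderiv (0, u) (dirderiv (\<alpha>, 0) B)) (\<xi>0, \<eta>0)
          + dirderiv (0, a) (dirderiv (\<alpha>, 0) B) (\<xi>0, \<eta>0) = 0" .
      have wD: "has_second_derivative w
          (dirderiv (v, 0) (dirderiv (v, 0) U) (\<xi>0, \<eta>0) + dirderiv (\<alpha>, 0) U (\<xi>0, \<eta>0)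
            + (dirderiv (v, 0) (dirderiv (v, 0) A) (\<xi>0, \<eta>0) + dirderiv (\<alpha>, 0) A (\<xi>0, \<eta>0))) 0"
        unfolding w_def U_def A_def by (intro has_second_derivative_add along\<gamma> dB2)
      \<comment> \<open>\<open>wD\<close> carries the s-derivatives outermost, \<open>m\<close> and
        \<open>zero\<close> carry the t-derivatives outermost; the exchanges are made at the base
        point only.\<close>
      have "dirderiv (v, 0) (dirderiv (v, 0) U) (\<xi>0, \<eta>0)
          = dirderiv (0, u) (dirderiv (0, u) (dirderiv (v, 0) (dirderiv (v, 0) B))) (\<xi>0, \<eta>0)"
        unfolding U_def by (rule dirderiv_commute4[OF V_open mem B4])
      moreover have "dirderiv (v, 0) (dirderiv (v, 0) A) (\<xi>0, \<eta>0)
          = dirderiv (0, a) (dirderiv (v, 0) (dirderiv (v, 0) B)) (\<xi>0, \<eta>0)"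
        unfolding A_def by (rule dirderiv_commute3[OF V_open mem Ck_on_SucD[OF B4]])
      moreover have "dirderiv (\<alpha>, 0) U (\<xi>0, \<eta>0)
          = dirderiv (0, u) (dirderiv (0, u) (dirderiv (\<alpha>, 0) B)) (\<xi>0, \<eta>0)"
        unfolding U_def by (rule dirderiv_commute3[OF V_open mem Ck_on_SucD[OF B4], symmetric])
      moreover have "dirderiv (\<alpha>, 0) A (\<xi>0, \<eta>0) = dirderiv (0, a) (dirderiv (\<alpha>, 0) B) (\<xi>0, \<eta>0)"
        unfolding A_def by (rule dirderiv_commute[OF V_open B2 mem])
      ultimately have "dirderiv (v, 0) (dirderiv (v, 0) U) (\<xi>0, \<eta>0) + dirderiv (\<alpha>, 0) U (\<xi>0, \<eta>0)
          + (dirderiv (v, 0) (dirderiv (v, 0) A) (\<xi>0, \<eta>0) + dirderiv (\<alpha>, 0) A (\<xi>0, \<eta>0)) = m"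
        using zero by (simp add: m_def)
      with wD show ?thesis by simp
    qed
    ultimately show "\<exists>w. (\<forall>\<^sub>F s in nhds 0. has_second_derivative
        (\<lambda>t. b (\<beta> s) (bexp c Y b x (t *\<^sub>R (D12 c e b x y *v u) + D1 c b x y))) (w s) 0) \<and>
        has_second_derivative w m 0"
      using u q by (auto simp: yb_def u_def)
  qed
  ultimately show ?thesis using that \<eta>' by (simp add: \<eta>_def yb_def)
qed

text \<open>Neither \<open>zt\<close> nor \<open>yt\<close> is assumed continuous. Their regularity
  near 0 is inherited from the curve b-exp(tp + q), with which \<open>yt\<close> is shown to
  coincide there.\<close>

lemma h_segment_curvature:
  assumes x: "x \<in> X" and y0: "y0 \<in> Y"
    and c: "c \<in> charts_at AX x" and d: "d \<in> charts_at AZ (zm x y0)" and e: "e \<in> charts_at AY y0"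
    and I: "open I" "0 \<in> I"
    and zt: "\<And>t. t \<in> I \<Longrightarrow> zt t \<in> Z \<and> D1 c h x (zt t) = t *\<^sub>R p + q" "zt 0 = zm x y0"
    and yt: "\<And>t a. t \<in> I \<Longrightarrow> a \<in> charts_at AZ (zt t) \<Longrightarrow>
          yt t \<in> closure Y \<and> D2 a g (yt t) (zt t) = - D2 a h x (zt t)"
  shows "\<exists>u m. ((\<lambda>t. snd e (yt t)) has_vector_derivative u) (at 0) \<and>
           has_MTW AX X Y b c e x y0 v u m \<and>
           has_second_derivative
             (\<lambda>t. v \<bullet> ((D11 c h x (zt t)
                - D12 c d h x (zt t) ** matrix_inv (D22 d h x (zt t) + D22 d g (yt t) (zt t))
                    ** transpose (D12 c d h x (zt t))) *v v)) m 0"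
proof -
  note c' = smooth_atlas_chart[OF manifolds(1) c] and d' = smooth_atlas_chart[OF manifolds(3) d]
    and e' = smooth_atlas_chart[OF manifolds(2) e]
  \<comment> \<open>Since \<open>zt 0\<close> is the maximizer for \<open>(x, y0)\<close>, the curve
    b-exp with the same \<open>p\<close> and \<open>q\<close> starts at \<open>y0\<close>.\<close>
  have q: "D1 c b x y0 = q"
    using zt(1)[OF I(2)] by (simp add: envelope[OF x y0 c] zt(2))
  define yb where "yb = (\<lambda>t. bexp c Y b x (t *\<^sub>R p + q))"
  obtain u m where *: "((\<lambda>t. snd e (yb t)) has_vector_derivative u) (at 0)"
    "has_MTW AX X Y b c e x y0 v u m"
    "has_second_derivative (\<lambda>t. v \<bullet> (D11 c b x (yb t) *v v)) m 0"
    using MTW_eq[OF x y0 c e q] unfolding yb_def .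
  have yb: "\<forall>\<^sub>F t in nhds 0. yb t \<in> Y \<inter> fst e \<and> D1 c b x (yb t) = t *\<^sub>R p + q" and yb0: "yb 0 = y0"
    using bexp_curve[OF x y0 c e q, of p] unfolding yb_def by auto
  have "((\<lambda>t. snd e (yb t)) \<longlongrightarrow> snd e y0) (nhds 0)"
    using has_derivative_continuous[OF *(1)[unfolded has_vector_derivative_def]]
      tendsto_at_iff_tendsto_nhds[of "\<lambda>t. snd e (yb t)" 0] by (simp add: isCont_def yb0)
  moreover have "isCont (chart_inv e) (snd e y0)"
    using e' by (intro isCont_chart_inv) auto
  ultimately have "((\<lambda>t. chart_inv e (snd e (yb t))) \<longlongrightarrow> y0) (nhds 0)"
    using e' isCont_tendsto_compose[of "snd e y0" "chart_inv e"] by (simp add: chart_inv_left)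
  moreover have "\<forall>\<^sub>F t in nhds 0. chart_inv e (snd e (yb t)) = yb t"
    using yb by eventually_elim (use e' in \<open>simp add: chart_inv_left\<close>)
  ultimately have yblim: "(yb \<longlongrightarrow> y0) (nhds 0)"
    by (rule Lim_transform_eventually)
  \<comment> \<open>\<open>hessian\<close> is applied at each small \<open>t\<close> in the one
    chart \<open>d\<close> chosen at the initial point, so the moving maximizer has to stay in its
    domain.\<close>
  have "((\<lambda>t. zm x (yb t)) \<longlongrightarrow> zm x y0) (nhds 0)"
    by (rule zmax_tendsto[OF x y0 tendsto_const yblim])
  then have evd: "\<forall>\<^sub>F t in nhds 0. zm x (yb t) \<in> fst d"
    using d' by (intro topological_tendstoD[of _ _ _ "fst d"]) (auto simp: is_chart_def)
  have evI: "\<forall>\<^sub>F t in nhds 0. t \<in> I" using I by (rule eventually_nhds_in_open)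
  have ev: "\<forall>\<^sub>F t in nhds 0. yt t = yb t \<and> zt t = zm x (yb t) \<and> yb t \<in> Y \<and> d \<in> charts_at AZ (zm x (yb t))"
    using yb evd evI
  proof eventually_elim
    case (elim t)
    then have y: "yb t \<in> Y" by simp
    have inj: "inj_on (D1 c h x) (closure Z)"
      using h_twist c x in_closure by (simp add: twisted1_def)
    have "D1 c h x (zt t) = D1 c h x (zm x (yb t))"
      using elim zt(1) envelope[OF x y c] by simp
    then have zeq: "zt t = zm x (yb t)"
      using zt(1) elim zmax_mem[OF x y] in_closure(3) by (intro inj_onD[OF inj]) auto
    have d_at: "d \<in> charts_at AZ (zt t)" using elim d by (simp add: charts_at_def zeq)
    have inj2: "inj_on (\<lambda>y. D2 d g y (zt t)) (closure Y)"
      using g_twist d_at zt(1)[of t] elim in_closure(3) by (simp add: twisted2_def)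
    have "D2 d g (yt t) (zt t) = D2 d g (yb t) (zt t)"
      using first_order_condition[OF x y] yt[OF _ d_at] d_at elim by (simp add: zeq)
    then have "yt t = yb t"
      using yt[OF _ d_at] elim y in_closure(2) by (intro inj_onD[OF inj2]) auto
    then show ?case using zeq y d_at by simp
  qed
  have "((\<lambda>t. snd e (yt t)) has_vector_derivative u) (at 0)"
    unfolding has_vector_derivative_def
    by (rule has_derivative_cong_nhds[OF *(1)[unfolded has_vector_derivative_def]])
      (use ev in \<open>auto elim: eventually_mono\<close>)
  moreover have "has_second_derivative
      (\<lambda>t. v \<bullet> ((D11 c h x (zt t)
         - D12 c d h x (zt t) ** matrix_inv (D22 d h x (zt t) + D22 d g (yt t) (zt t))
             ** transpose (D12 c d h x (zt t))) *v v)) m 0"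
  proof (rule has_second_derivative_cong[OF *(3)])
    show "\<forall>\<^sub>F t in nhds 0. v \<bullet> (D11 c b x (yb t) *v v) = v \<bullet> ((D11 c h x (zt t)
         - D12 c d h x (zt t) ** matrix_inv (D22 d h x (zt t) + D22 d g (yt t) (zt t))
             ** transpose (D12 c d h x (zt t))) *v v)"
      using ev
    proof eventually_elim
      case (elim t)
      then show ?case using hessian[OF x _ refl c, of "yb t" d] by simp
    qed
  qed
  ultimately show ?thesis using *(2) by blast
qed

end

theorem theorem3p6:
  fixes AX :: "('mx::{t2_space,second_countable_topology}, 'n::finite) chart set"
    and AY :: "('my::{t2_space,second_countable_topology}, 'n) chart set"
    and AZ :: "('mz::{t2_space,second_countable_topology}, 'n) chart set"
    and X :: "'mx set" and Y :: "'my set" and Z :: "'mz set"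
    and h :: "'mx \<Rightarrow> 'mz \<Rightarrow> real" and g :: "'my \<Rightarrow> 'mz \<Rightarrow> real" and b :: "'mx \<Rightarrow> 'my \<Rightarrow> real"
    and x :: 'mx and z :: 'mz and v p q :: "real ^ 'n"
    and I :: "real set" and zt :: "real \<Rightarrow> 'mz" and yt :: "real \<Rightarrow> 'my"
  assumes manifolds: "smooth_atlas AX" "smooth_atlas AY" "smooth_atlas AZ"
    and opens: "open X" "open Y" "open Z"
    and compact_closures: "compact (closure X)" "compact (closure Y)" "compact (closure Z)"
    and h_C2: "Ck_prod AX AZ 2 (closure X \<times> closure Z) h"
    and g_C2: "Ck_prod AY AZ 2 (closure Y \<times> closure Z) g"
    and b_sup: "\<And>x y. x \<in> closure X \<Longrightarrow> y \<in> closure Y \<Longrightarrow> b x y = (SUP z\<in>Z. h x z + g y z)"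
    and unique_max: "\<And>x y. x \<in> X \<Longrightarrow> y \<in> Y \<Longrightarrow> \<exists>!z. is_maximizer Z h g x y z"
    and nonsingular: "\<And>x y d. x \<in> X \<Longrightarrow> y \<in> Y \<Longrightarrow> d \<in> charts_at AZ (zmax Z h g x y) \<Longrightarrow>
          invertible (D22 d h x (zmax Z h g x y) + D22 d g y (zmax Z h g x y))"
    and h_twist: "twisted1 AX (closure X) (closure Z) h"
    and g_twist: "twisted2 AZ (closure Y) (closure Z) g"
    and A0: "Ck_prod AX AY 4 (closure X \<times> closure Y) b"
    and A1: "twisted1 AX (closure X) (closure Y) b" "twisted2 AY (closure X) (closure Y) b"
    and A2: "\<And>x y c e. x \<in> X \<Longrightarrow> y \<in> Y \<Longrightarrow> c \<in> charts_at AX x \<Longrightarrow> e \<in> charts_at AY y \<Longrightarrow>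
          invertible (D12 c e b x y)"
    and b_convex: "cost_convex AX X Y b"
    and x: "x \<in> X" and z: "z \<in> Z"
    and c: "c \<in> charts_at AX x" and d: "d \<in> charts_at AZ z" and e: "e \<in> charts_at AY (yt 0)"
    and I: "open I" "is_interval I" "0 \<in> I"
    and h_segment: "\<And>t. t \<in> I \<Longrightarrow> zt t \<in> Z \<and> D1 c h x (zt t) = t *\<^sub>R p + q"
    and zt_0: "zt 0 = z"
    and yt: "\<And>t a. t \<in> I \<Longrightarrow> a \<in> charts_at AZ (zt t) \<Longrightarrow>
          yt t \<in> closure Y \<and> D2 a g (yt t) (zt t) = - D2 a h x (zt t)"
    and yt_0: "yt 0 \<in> Y" "z = zmax Z h g x (yt 0)"
  shows "\<exists>u m. ((\<lambda>t. snd e (yt t)) has_vector_derivative u) (at 0) \<and>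
           has_MTW AX X Y b c e x (yt 0) v u m \<and>
           has_second_derivative
             (\<lambda>t. v \<bullet> ((D11 c h x (zt t)
                - D12 c d h x (zt t) ** matrix_inv (D22 d h x (zt t) + D22 d g (yt t) (zt t))
                    ** transpose (D12 c d h x (zt t))) *v v)) m 0"
proof -
  interpret sup_cost AX AY AZ X Y Z h g b
    by unfold_locales (fact assms)+
  show ?thesis
    using h_segment_curvature[OF x yt_0(1) c _ e I(1,3) h_segment _ yt] d zt_0 yt_0(2) by simp
qed

end
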